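(* Let $f\in\mathcal H_1$. The two conditions $$\lim_{|\gamma|\to1^-}|f^{\boldsymbol{e_\ell}}(\gamma)|=1\qquad\text{and}\qquad\lim_{|\gamma|\to1^-}|f^{\boldsymbol{e_r}}(\gamma)|=1$$ are equivalent, and if they hold, then $f$ is a finite Blaschke product.
   Context: $\mathbb H$ is the skew field of real quaternions with conjugation $\alpha\mapsto\overline\alpha$ and modulus $|\cdot|$; $\mathbb B_1=\{\alpha\in\mathbb H:|\alpha|<1\}$. $\mathbb H[[z]]$ is the ring of formal power series in a variable $z$ commuting with the quaternionic coefficients, with the Cauchy product $(fg)_k=\sum_{\ell=0}^kf_\ell g_{k-\ell}$. $\mathcal H_1$ is the ring of $f=\sum_kf_kz^k\in\mathbb H[[z]]$ with $\limsup_k|f_k|^{1/k}\le1$. For $f\in\mathcal H_1$ and $\gamma\in\mathbb B_1$ the left and right values are $f^{\boldsymbol{e_\ell}}(\gamma)=\sum_k\gamma^kf_k$ and $f^{\boldsymbol{e_r}}(\gamma)=\sum_kf_k\gamma^k$. The limit as $|\gamma|\to1^-$ is over $\gamma\in\mathbb B_1$: for every $\varepsilon>0$ there is $\delta>0$ such that $\big||f^{\boldsymbol{e_\ell}}(\gamma)|-1\big|<\varepsilon$ whenever $1-\delta<|\gamma|<1$ (and similarly for right values). For $\alpha\in\mathbb B_1$, the Blaschke factor is ${\bf b}_\alpha(z)=(z-\alpha)\sum_{k\ge0}\overline\alpha^kz^k$. A finite Blaschke product of degree $n\ge0$ is a power series ${\bf b}_{\alpha_1}\cdots{\bf b}_{\alpha_n}\phi$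 with $\alpha_1,\dots,\alpha_n\in\mathbb B_1$ and $\phi\in\mathbb H$, $|\phi|=1$ (unimodular constants have degree $0$). *)

theory Defs
  imports "HOL-Analysis.Analysis"
begin

section \<open>The skew field of real quaternions\<close>

codatatype quat = Quat (qre: real) (qi: real) (qj: real) (qk: real)

lemma quat_eqI:
  "qre x = qre y \<Longrightarrow> qi x = qi y \<Longrightarrow> qj x = qj y \<Longrightarrow> qk x = qk y \<Longrightarrow> x = y"
  by (rule quat.expand) simp

lemma quat_eq_iff:
  "x = y \<longleftrightarrow> qre x = qre y \<and> qi x = qi y \<and> qj x = qj y \<and> qk x = qk y"
  by (auto intro: quat_eqI)

primcorec qcnj :: "quat \<Rightarrow> quat" where
  "qre (qcnj x) = qre x"
| "qi (qcnj x) = - qi x"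
| "qj (qcnj x) = - qj x"
| "qk (qcnj x) = - qk x"

instantiation quat :: ab_group_add
begin

primcorec zero_quat where
  "qre 0 = 0" | "qi 0 = 0" | "qj 0 = 0" | "qk 0 = 0"

primcorec plus_quat where
  "qre (x + y) = qre x + qre y"
| "qi (x + y) = qi x + qi y"
| "qj (x + y) = qj x + qj y"
| "qk (x + y) = qk x + qk y"

primcorec uminus_quat where
  "qre (- x) = - qre x"
| "qi (- x) = - qi x"
| "qj (- x) = - qj x"
| "qk (- x) = - qk x"

primcorec minus_quat where
  "qre (x - y) = qre x - qre y"
| "qi (x - y) = qi x - qi y"
| "qj (x - y) = qj x - qj y"
| "qk (x - y) = qk x - qk y"

instance
  by standard (simp_all add: quat_eq_iff)

end

instantiation quat :: ring_1
begin

primcorec one_quat where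
  "qre 1 = 1" | "qi 1 = 0" | "qj 1 = 0" | "qk 1 = 0"

primcorec times_quat where
  "qre (x * y) = qre x * qre y - qi x * qi y - qj x * qj y - qk x * qk y"
| "qi (x * y) = qre x * qi y + qi x * qre y + qj x * qk y - qk x * qj y"
| "qj (x * y) = qre x * qj y - qi x * qk y + qj x * qre y + qk x * qi y"
| "qk (x * y) = qre x * qk y + qi x * qj y - qj x * qi y + qk x * qre y"

instance
  by standard (simp_all add: quat_eq_iff algebra_simps)

end

instantiation quat :: real_algebra_1
begin

primcorec scaleR_quat where
  "qre (scaleR r x) = r * qre x"
| "qi (scaleR r x) = r * qi x"
| "qj (scaleR r x) = r * qj x"
| "qk (scaleR r x) = r * qk x"

instance
  by standard (simp_all add: quat_eq_iff algebra_simps)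

end

instantiation quat :: real_inner
begin

definition inner_quat :: "quat \<Rightarrow> quat \<Rightarrow> real" where
  "inner_quat x y = qre x * qre y + qi x * qi y + qj x * qj y + qk x * qk y"

definition norm_quat :: "quat \<Rightarrow> real" where
  "norm_quat x = sqrt ((qre x)\<^sup>2 + (qi x)\<^sup>2 + (qj x)\<^sup>2 + (qk x)\<^sup>2)"

definition sgn_quat :: "quat \<Rightarrow> quat" where
  "sgn_quat x = x /\<^sub>R norm x"

definition dist_quat :: "quat \<Rightarrow> quat \<Rightarrow> real" where
  "dist_quat x y = norm (x - y)"

definition uniformity_quat :: "(quat \<times> quat) filter" where
  "uniformity_quat = (INF e\<in>{0 <..}. principal {(x, y). dist x y < e})"

definition open_quat :: "quat set \<Rightarrow> bool" where
  "open_quat U \<longleftrightarrow> (\<forall>x\<in>U. \<forall>\<^sub>F (x', y) in uniformity. x' = x \<longrightarrow> y \<in> U)"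

instance
proof
  fix x y z :: quat and r :: real and U :: "quat set"
  show "dist x y = norm (x - y)" by (rule dist_quat_def)
  show "sgn x = x /\<^sub>R norm x" by (rule sgn_quat_def)
  show "uniformity = (INF e\<in>{0 <..}. principal {(x, y). dist x (y :: quat) < e})"
    by (rule uniformity_quat_def)
  show "open U \<longleftrightarrow> (\<forall>x\<in>U. \<forall>\<^sub>F (x', y) in uniformity. x' = x \<longrightarrow> y \<in> U)"
    by (rule open_quat_def)
  show "inner x y = inner y x" by (simp add: inner_quat_def mult.commute)
  show "inner (x + y) z = inner x z + inner y z"
    by (simp add: inner_quat_def algebra_simps)
  show "inner (r *\<^sub>R x) y = r * inner x y"
    by (simp add: inner_quat_def algebra_simps)
  show "0 \<le> inner x x" by (simp add: inner_quat_def)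
  show "inner x x = 0 \<longleftrightarrow> x = 0"
    by (simp add: inner_quat_def quat_eq_iff add_nonneg_eq_0_iff)
  show "norm x = sqrt (inner x x)"
    by (simp add: norm_quat_def inner_quat_def power2_eq_square)
qed

end

lemma norm_quat_power2: "(norm (x :: quat))\<^sup>2 = (qre x)\<^sup>2 + (qi x)\<^sup>2 + (qj x)\<^sup>2 + (qk x)\<^sup>2"
  by (simp add: norm_quat_def)

lemma quat_mult_qcnj: "x * qcnj x = of_real ((norm x)\<^sup>2)"
  by (simp add: quat_eq_iff of_real_def norm_quat_power2) (simp add: power2_eq_square)

lemma qcnj_mult_quat: "qcnj x * x = of_real ((norm x)\<^sup>2)"
  by (simp add: quat_eq_iff of_real_def norm_quat_power2) (simp add: power2_eq_square)

instantiation quat :: real_normed_div_algebra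
begin

definition inverse_quat :: "quat \<Rightarrow> quat" where
  "inverse_quat x = qcnj x /\<^sub>R (norm x)\<^sup>2"

definition divide_quat :: "quat \<Rightarrow> quat \<Rightarrow> quat" where
  "divide_quat x y = x * inverse y"

instance
proof
  fix x y :: quat
  show "x \<noteq> 0 \<Longrightarrow> inverse x * x = 1"
    by (simp add: inverse_quat_def qcnj_mult_quat of_real_def)
  show "x \<noteq> 0 \<Longrightarrow> x * inverse x = 1"
    by (simp add: inverse_quat_def quat_mult_qcnj of_real_def)
  show "x div y = x * inverse y" by (rule divide_quat_def)
  show "inverse (0 :: quat) = 0"
    by (simp add: inverse_quat_def quat_eq_iff)
  have "(norm (x * y))\<^sup>2 = (norm x * norm y)\<^sup>2"
    unfolding power_mult_distrib norm_quat_power2 times_quat.sel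
    by (simp only: power2_eq_square algebra_simps)
  then show "norm (x * y) = norm x * norm y"
    by (rule power2_eq_imp_eq) simp_all
qed

end

instantiation quat :: euclidean_space
begin

definition Basis_quat :: "quat set" where
  "Basis_quat = {Quat 1 0 0 0, Quat 0 1 0 0, Quat 0 0 1 0, Quat 0 0 0 1}"

instance
proof
  show "(Basis :: quat set) \<noteq> {}" "finite (Basis :: quat set)"
    by (simp_all add: Basis_quat_def)
next
  fix u v :: quat
  assume "u \<in> Basis" "v \<in> Basis"
  then show "inner u v = (if u = v then 1 else 0)"
    unfolding Basis_quat_def by (elim insertE emptyE) (simp_all add: inner_quat_def)
next
  fix x :: quat
  show "(\<forall>u\<in>Basis. inner x u = 0) \<longleftrightarrow> x = 0"
    by (simp add: Basis_quat_def inner_quat_def) (simp add: quat_eq_iff)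
qed

end

section \<open>Quaternionic power series\<close>

definition H1 :: "quat fps set" where
  "H1 = {f. limsup (\<lambda>k. ereal (root k (norm (fps_nth f k)))) \<le> 1}"

text \<open>
  The library function \<^const>\<open>eval_fps\<close> puts the powers of the argument to the right of the
  coefficients, so over the quaternions it is the right value. The left value is its mirror image.
\<close>

definition eval_fps_left :: "quat fps \<Rightarrow> quat \<Rightarrow> quat" where
  "eval_fps_left f \<gamma> = (\<Sum>k. \<gamma> ^ k * fps_nth f k)"

text \<open>The filter of the limit \<open>|\<gamma>| \<rightarrow> 1\<close> from inside the unit ball.\<close>

definition to_unit_sphere :: "quat filter" where
  "to_unit_sphere = filtercomap norm (at_left 1)"

lemma tendsto_to_unit_sphere_iff:
  fixes F :: "quat \<Rightarrow> real"
  shows "(F \<longlongrightarrow> L) to_unit_sphere \<longleftrightarrow>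
    (\<forall>\<epsilon>>0. \<exists>\<delta>>0. \<forall>\<gamma>. 1 - \<delta> < norm \<gamma> \<and> norm \<gamma> < 1 \<longrightarrow> \<bar>F \<gamma> - L\<bar> < \<epsilon>)"
proof -
  have *: "eventually P to_unit_sphere \<longleftrightarrow>
      (\<exists>\<delta>>0. \<forall>\<gamma>. 1 - \<delta> < norm \<gamma> \<and> norm \<gamma> < 1 \<longrightarrow> P \<gamma>)" (is "?L \<longleftrightarrow> ?R") for P
  proof
    assume ?L
    then obtain Q b where b: "b < 1" "\<And>y. y > b \<Longrightarrow> y < 1 \<Longrightarrow> Q y" and Q: "\<And>\<gamma>. Q (norm \<gamma>) \<Longrightarrow> P \<gamma>"
      unfolding to_unit_sphere_def eventually_filtercomap
      using eventually_at_left[of "0::real" 1] by auto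
    then show ?R by (intro exI[of _ "1 - b"]) auto
  next
    assume ?R
    then obtain \<delta> where "\<delta> > 0" and P: "\<And>\<gamma>. 1 - \<delta> < norm \<gamma> \<Longrightarrow> norm \<gamma> < 1 \<Longrightarrow> P \<gamma>"
      by blast
    then have "eventually (\<lambda>y. 1 - \<delta> < y \<and> y < 1) (at_left (1::real))"
      using eventually_at_left[of "0::real" 1] by (auto intro!: exI[of _ "1 - \<delta>"])
    with P show ?L
      unfolding to_unit_sphere_def eventually_filtercomap by blast
  qed
  show ?thesis
    unfolding tendsto_iff * dist_real_def ..
qed

section \<open>Blaschke products\<close>

definition blaschke_factor :: "quat \<Rightarrow> quat fps" where
  "blaschke_factor \<alpha> = (fps_X - fps_const \<alpha>) * Abs_fps (\<lambda>k. qcnj \<alpha> ^ k)"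

definition blaschke_product_of_degree :: "nat \<Rightarrow> quat fps \<Rightarrow> bool" where
  "blaschke_product_of_degree n f \<longleftrightarrow>
     (\<exists>\<alpha>s \<phi>. length \<alpha>s = n \<and> set \<alpha>s \<subseteq> ball 0 1 \<and> norm \<phi> = 1 \<and>
        f = prod_list (map blaschke_factor \<alpha>s) * fps_const \<phi>)"

definition finite_blaschke_product :: "quat fps \<Rightarrow> bool" where
  "finite_blaschke_product f \<longleftrightarrow> (\<exists>n. blaschke_product_of_degree n f)"

end

theory Submission
  imports Defs "HOL-Complex_Analysis.Complex_Analysis"
begin

text \<open>
  For \<open>w = x + iy\<close> in the unit disc let \<open>A + iB\<close> be the value of \<open>f\<close> at \<open>w\<close> in the complexified
  quaternions (the \<open>2 \<times> 2\<close> complex matrices). The left and right values of \<open>f\<close> at \<open>x + yI\<close> are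
  \<open>A + IB\<close> and \<open>A + BI\<close>, and each of the two limits, being uniform in the imaginary unit \<open>I\<close>, says that
  \<open>|A|\<^sup>2 + |B|\<^sup>2\<close> and the modulus of the determinant \<open>|A|\<^sup>2 - |B|\<^sup>2 + 2i\<langle>A, B\<rangle>\<close> tend to 1, that is, that
  the matrix \<open>A + iB\<close> becomes unitary at the boundary. This condition is symmetric in left and right.

  The determinant is the value at \<open>w\<close> of a power series with real coefficients, and each of its zeros in the
  disc comes from a left zero \<open>\<alpha>\<close> of \<open>f\<close> with \<open>|\<alpha>| = |w|\<close>, which can be divided out as a Blaschke factor.
  Only finitely many divisions are possible. If the determinant has no zeros, then \<open>f\<close> is invertible in
  the ring of series in question. By Cauchy's inequality the coefficients of a boundary unitary series are
  bounded by 1, so \<open>|f\<^sub>0| = 1\<close>; as the same bound holds for all powers of \<open>f\<close>, the series is constant.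
\<close>

section \<open>Quaternions\<close>

definition imag_unit :: "quat \<Rightarrow> bool" where
  "imag_unit u \<longleftrightarrow> qre u = 0 \<and> norm u = 1"

lemma imag_unit_iff: "imag_unit u \<longleftrightarrow> qre u = 0 \<and> (qi u)\<^sup>2 + (qj u)\<^sup>2 + (qk u)\<^sup>2 = 1"
  using norm_quat_power2[of u]
  by (auto simp: imag_unit_def) (auto simp: norm_quat_def)

lemma imag_unit_axes:
  "imag_unit (Quat 0 1 0 0)" "imag_unit (Quat 0 0 1 0)" "imag_unit (Quat 0 0 0 1)"
  by (simp_all add: imag_unit_iff)

lemma imag_unit_uminus: "imag_unit u \<Longrightarrow> imag_unit (- u)"
  by (simp add: imag_unit_def)

lemma imag_unit_square:
  assumes "imag_unit u"
  shows "u * u = - 1"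
proof -
  have "qi u * qi u + qj u * qj u + qk u * qk u = 1" "qre u = 0"
    using assms by (simp_all add: imag_unit_iff power2_eq_square)
  then show ?thesis by (simp add: quat_eq_iff)
qed

text \<open>Conjugation by \<open>c\<close> rotates the purely imaginary quaternions. In
  \<open>boundary_unitary_mult\<close> this allows an imaginary unit to be moved past a left
  value.\<close>

lemma imag_unit_conj:
  assumes "imag_unit u" and "c \<noteq> 0"
  shows "imag_unit (inverse c * u * c)"
proof -
  have "norm (inverse c * u * c) = 1"
    using assms by (simp add: norm_mult norm_inverse imag_unit_def)
  moreover have "qre (qcnj c * u * c) = qre u * (norm c)\<^sup>2"
    unfolding norm_quat_power2 by (simp add: algebra_simps power2_eq_square)
  then have "qre (inverse c * u * c) = 0"
    using assms by (simp add: inverse_quat_def imag_unit_def)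
  ultimately show ?thesis by (simp add: imag_unit_def)
qed

lemma quat_polar:
  obtains w u where "imag_unit u" "\<gamma> = of_real (Re w) + Im w *\<^sub>R u"
proof
  define m where "m = \<gamma> - of_real (qre \<gamma>)"
  \<comment> \<open>A real \<open>\<gamma>\<close> lies on every slice; the unit i is then an
    arbitrary choice.\<close>
  define u where "u = (if m = 0 then Quat 0 1 0 0 else m /\<^sub>R norm m)"
  show "imag_unit u"
    using imag_unit_axes(1) by (auto simp: u_def imag_unit_def m_def of_real_def)
  show "\<gamma> = of_real (Re (Complex (qre \<gamma>) (norm m))) + Im (Complex (qre \<gamma>) (norm m)) *\<^sub>R u"
    by (auto simp: u_def m_def)
qed

text \<open>Since \<open>u * u = - 1\<close>, sending \<open>w\<close> to
  \<open>Re w + Im w u\<close> is a ring embedding of the complex numbers with image the plane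
  spanned by 1 and \<open>u\<close>.\<close>

lemma quat_slice_power:
  assumes "imag_unit u"
  shows "(of_real (Re w) + Im w *\<^sub>R u) ^ k = of_real (Re (w ^ k)) + Im (w ^ k) *\<^sub>R u"
proof (induction k)
  case (Suc k)
  show ?case
    using imag_unit_square[OF assms]
    by (simp only: power_Suc Suc.IH) (simp add: algebra_simps of_real_def scaleR_add_left scaleR_diff_left)
qed simp

lemma norm_quat_slice:
  assumes "imag_unit u"
  shows "norm (of_real (Re w) + Im w *\<^sub>R u) = cmod w"
proof -
  have "(norm (of_real (Re w) + Im w *\<^sub>R u))\<^sup>2 = (Re w)\<^sup>2 + (Im w)\<^sup>2 * ((qi u)\<^sup>2 + (qj u)\<^sup>2 + (qk u)\<^sup>2)"
    unfolding norm_quat_power2 using assms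
    by (simp add: imag_unit_def of_real_def algebra_simps power_mult_distrib)
  also have "\<dots> = (cmod w)\<^sup>2"
    using assms by (simp add: imag_unit_iff cmod_power2)
  finally show ?thesis by (rule power2_eq_imp_eq) simp_all
qed

section \<open>Inner products of quaternion products\<close>

lemma norm_add_power2:
  fixes a b :: "'a :: real_inner"
  shows "(norm (a + b))\<^sup>2 = (norm a)\<^sup>2 + (norm b)\<^sup>2 + 2 * inner a b"
  unfolding power2_norm_eq_inner by (simp add: inner_add inner_commute)

lemma norm_add_imag_unit_mult:
  assumes "imag_unit u"
  shows "(norm (a + u * b))\<^sup>2 = (norm a)\<^sup>2 + (norm b)\<^sup>2 + 2 * inner a (u * b)"
  using assms by (simp add: norm_add_power2 imag_unit_def norm_mult)

lemma norm_add_mult_imag_unit: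
  assumes "imag_unit u"
  shows "(norm (a + b * u))\<^sup>2 = (norm a)\<^sup>2 + (norm b)\<^sup>2 + 2 * inner a (b * u)"
  using assms by (simp add: norm_add_power2 imag_unit_def norm_mult)

lemma inner_mult_left_quat: "inner (a * x) (a * y) = (norm a)\<^sup>2 * inner x y" for a :: quat
  unfolding norm_quat_power2 inner_quat_def times_quat.sel
  by (simp add: algebra_simps power2_eq_square)

lemma inner_mult_right_quat: "inner (x * a) (y * a) = (norm a)\<^sup>2 * inner x y" for a :: quat
  unfolding norm_quat_power2 inner_quat_def times_quat.sel
  by (simp add: algebra_simps power2_eq_square)

text \<open>Polarization of \<open>|x y|^2 = |x|^2 |y|^2\<close> in both factors. It evaluates the
  mixed terms in \<open>slice_det_mult\<close>.\<close>

lemma inner_mult_polarization: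
  "inner (a * c) (b * d) + inner (a * d) (b * c) = 2 * inner a b * inner c d" for a :: quat
  unfolding inner_quat_def times_quat.sel
  by (simp add: algebra_simps)

text \<open>For nonzero \<open>b\<close> the quaternions b, ib, jb, kb are pairwise orthogonal of
  length |b|. This is Parseval's identity for \<open>a\<close> in that basis, with the term of b
  moved to the right.\<close>

lemma lagrange_left:
  "(inner a (Quat 0 1 0 0 * b))\<^sup>2 + (inner a (Quat 0 0 1 0 * b))\<^sup>2 + (inner a (Quat 0 0 0 1 * b))\<^sup>2
    = (norm a)\<^sup>2 * (norm b)\<^sup>2 - (inner a b)\<^sup>2"
  unfolding norm_quat_power2 inner_quat_def times_quat.sel quat.sel
  by (simp add: algebra_simps power2_eq_square)

lemma lagrange_right:
  "(inner a (b * Quat 0 1 0 0))\<^sup>2 + (inner a (b * Quat 0 0 1 0))\<^sup>2 + (inner a (b * Quat 0 0 0 1))\<^sup>2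
    = (norm a)\<^sup>2 * (norm b)\<^sup>2 - (inner a b)\<^sup>2"
  unfolding norm_quat_power2 inner_quat_def times_quat.sel quat.sel
  by (simp add: algebra_simps power2_eq_square)

lemma cauchy_schwarz3:
  fixes a b c x y z :: real
  assumes "a\<^sup>2 + b\<^sup>2 + c\<^sup>2 = 1"
  shows "(a * x + b * y + c * z)\<^sup>2 \<le> x\<^sup>2 + y\<^sup>2 + z\<^sup>2"
proof -
  have "(a\<^sup>2 + b\<^sup>2 + c\<^sup>2) * (x\<^sup>2 + y\<^sup>2 + z\<^sup>2) - (a * x + b * y + c * z)\<^sup>2
     = (a * y - b * x)\<^sup>2 + (a * z - c * x)\<^sup>2 + (b * z - c * y)\<^sup>2"
    by (simp add: algebra_simps power2_eq_square)
  also have "\<dots> \<ge> 0" by simp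
  finally show ?thesis unfolding assms by simp
qed

text \<open>The inner product is linear in the three coordinates of \<open>u\<close>, so
  Cauchy-Schwarz together with \<open>lagrange_left\<close> gives a bound that does not depend on
  \<open>u\<close>.\<close>

lemma inner_imag_unit_left_le:
  assumes "imag_unit u"
  shows "(inner a (u * b))\<^sup>2 \<le> (norm a)\<^sup>2 * (norm b)\<^sup>2 - (inner a b)\<^sup>2"
proof -
  have "inner a (u * b) = qi u * inner a (Quat 0 1 0 0 * b) + qj u * inner a (Quat 0 0 1 0 * b)
      + qk u * inner a (Quat 0 0 0 1 * b)"
    using assms unfolding imag_unit_def inner_quat_def times_quat.sel quat.sel
    by (simp add: algebra_simps)
  then show ?thesis
    unfolding lagrange_left[symmetric] using assms by (simp only: imag_unit_iff cauchy_schwarz3)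
qed

lemma inner_imag_unit_right_le:
  assumes "imag_unit u"
  shows "(inner a (b * u))\<^sup>2 \<le> (norm a)\<^sup>2 * (norm b)\<^sup>2 - (inner a b)\<^sup>2"
proof -
  have "inner a (b * u) = qi u * inner a (b * Quat 0 1 0 0) + qj u * inner a (b * Quat 0 0 1 0)
      + qk u * inner a (b * Quat 0 0 0 1)"
    using assms unfolding imag_unit_def inner_quat_def times_quat.sel quat.sel
    by (simp add: algebra_simps)
  then show ?thesis
    unfolding lagrange_right[symmetric] using assms by (simp only: imag_unit_iff cauchy_schwarz3)
qed

section \<open>Quaternionic conjugation\<close>

lemma qcnj_mult: "qcnj (x * y) = qcnj y * qcnj x"
  by (simp add: quat_eq_iff algebra_simps)

lemma qcnj_add: "qcnj (x + y) = qcnj x + qcnj y"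
  by (simp add: quat_eq_iff)

lemma qcnj_scaleR: "qcnj (r *\<^sub>R x) = r *\<^sub>R qcnj x"
  by (simp add: quat_eq_iff)

lemma norm_qcnj [simp]: "norm (qcnj x) = norm x"
  by (simp add: norm_quat_def)

lemma qcnj_qcnj [simp]: "qcnj (qcnj x) = x"
  by (simp add: quat_eq_iff)

lemma inner_qcnj [simp]: "inner (qcnj x) (qcnj y) = inner x y"
  by (simp add: inner_quat_def)

lemma bounded_linear_qcnj: "bounded_linear qcnj"
  by (rule bounded_linear_intro[of _ 1]) (simp_all add: qcnj_add qcnj_scaleR)

lemma qcnj_sum: "qcnj (sum f A) = (\<Sum>x\<in>A. qcnj (f x))"
  by (rule linear_sum) (rule bounded_linear.linear[OF bounded_linear_qcnj])

section \<open>Values of power series on complex slices\<close>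

definition slice_re :: "quat fps \<Rightarrow> complex \<Rightarrow> quat" where
  "slice_re f w = (\<Sum>k. Re (w ^ k) *\<^sub>R fps_nth f k)"

definition slice_im :: "quat fps \<Rightarrow> complex \<Rightarrow> quat" where
  "slice_im f w = (\<Sum>k. Im (w ^ k) *\<^sub>R fps_nth f k)"

text \<open>Half the squared Frobenius norm of the complex 2 x 2 matrix A + iB, that is, the mean of
  the squares of its two singular values; the modulus of \<open>slice_det\<close> is their
  product.\<close>

definition slice_sq :: "quat fps \<Rightarrow> complex \<Rightarrow> real" where
  "slice_sq f w = (norm (slice_re f w))\<^sup>2 + (norm (slice_im f w))\<^sup>2"

definition slice_det :: "quat fps \<Rightarrow> complex \<Rightarrow> complex" where
  "slice_det f w = Complex ((norm (slice_re f w))\<^sup>2 - (norm (slice_im f w))\<^sup>2)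
                           (2 * inner (slice_re f w) (slice_im f w))"

lemma H1_iff: "f \<in> H1 \<longleftrightarrow> 1 \<le> fps_conv_radius f"
proof -
  define L where "L = limsup (\<lambda>k. ereal (root k (norm (fps_nth f k))))"
  \<comment> \<open>The radius of convergence is \<open>inverse L\<close>; nonnegativity of
    \<open>L\<close> is what makes \<open>1 \<le> inverse L\<close> equivalent to
    \<open>L \<le> 1\<close>.\<close>
  have "0 = limsup (\<lambda>k::nat. 0 :: ereal)" by (simp add: Limsup_const)
  also have "\<dots> \<le> L" unfolding L_def by (intro Limsup_mono) (simp_all add: real_root_ge_zero)
  finally have "0 \<le> L" .
  then have "1 \<le> inverse L \<longleftrightarrow> L \<le> 1"
    by (cases L) (auto simp: one_ereal_def zero_ereal_def field_simps)
  then show ?thesis by (simp add: H1_def fps_conv_radius_def conv_radius_def L_def)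
qed

lemma H1_iff_summable:
  "f \<in> H1 \<longleftrightarrow> (\<forall>r. 0 < r \<and> r < 1 \<longrightarrow> summable (\<lambda>k. norm (fps_nth f k) * r ^ k))"
proof
  assume "f \<in> H1"
  then have *: "1 \<le> fps_conv_radius f" by (simp add: H1_iff)
  show "\<forall>r. 0 < r \<and> r < 1 \<longrightarrow> summable (\<lambda>k. norm (fps_nth f k) * r ^ k)"
  proof safe
    fix r :: real assume r: "0 < r" "r < 1"
    have "ereal (norm (of_real r :: quat)) < fps_conv_radius f"
      using r by (intro less_le_trans[OF _ *]) simp
    from norm_summable_fps[OF this] show "summable (\<lambda>k. norm (fps_nth f k) * r ^ k)"
      using r by (simp add: norm_mult norm_power)
  qed
next
  assume *: "\<forall>r. 0 < r \<and> r < 1 \<longrightarrow> summable (\<lambda>k. norm (fps_nth f k) * r ^ k)"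
  show "f \<in> H1"
    unfolding H1_iff fps_conv_radius_def
  proof (rule conv_radius_geI_ex')
    fix r :: real assume "0 < r" "ereal r < 1"
    then show "summable (\<lambda>n. fps_nth f n * of_real r ^ n)"
      using * by (intro summable_norm_cancel[of "\<lambda>n. fps_nth f n * of_real r ^ n"])
        (simp add: norm_mult norm_power)
  qed
qed

lemma H1_summable_norm:
  assumes "f \<in> H1" "cmod w < 1"
  shows "summable (\<lambda>k. norm (fps_nth f k) * cmod w ^ k)"
proof -
  have "ereal (norm (of_real (cmod w) :: quat)) < fps_conv_radius f"
    using assms by (intro less_le_trans[OF _ assms(1)[unfolded H1_iff]]) simp
  from norm_summable_fps[OF this] show ?thesis
    by (simp add: norm_mult norm_power)
qed

lemma H1_mult: "f \<in> H1 \<Longrightarrow> g \<in> H1 \<Longrightarrow> f * g \<in> H1"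
  unfolding H1_iff by (rule order_trans[OF _ fps_conv_radius_mult]) simp

lemma summable_slice_re:
  assumes "f \<in> H1" "cmod w < 1"
  shows "summable (\<lambda>k. norm (Re (w ^ k) *\<^sub>R fps_nth f k))"
  using H1_summable_norm[OF assms]
  by (rule summable_comparison_test'[where N = 0])
    (auto simp: mult.commute[of "\<bar>_\<bar>"] norm_power[symmetric] intro!: mult_left_mono abs_Re_le_cmod)

lemma summable_slice_im:
  assumes "f \<in> H1" "cmod w < 1"
  shows "summable (\<lambda>k. norm (Im (w ^ k) *\<^sub>R fps_nth f k))"
  using H1_summable_norm[OF assms]
  by (rule summable_comparison_test'[where N = 0])
    (auto simp: mult.commute[of "\<bar>_\<bar>"] norm_power[symmetric] intro!: mult_left_mono abs_Im_le_cmod)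

lemma slice_re_sums:
  assumes "f \<in> H1" "cmod w < 1"
  shows "(\<lambda>k. Re (w ^ k) *\<^sub>R fps_nth f k) sums slice_re f w"
  unfolding slice_re_def by (rule summable_sums[OF summable_norm_cancel[OF summable_slice_re[OF assms]]])

lemma slice_im_sums:
  assumes "f \<in> H1" "cmod w < 1"
  shows "(\<lambda>k. Im (w ^ k) *\<^sub>R fps_nth f k) sums slice_im f w"
  unfolding slice_im_def by (rule summable_sums[OF summable_norm_cancel[OF summable_slice_im[OF assms]]])

text \<open>\<open>Re (w ^ k)\<close> and \<open>Im (w ^ k)\<close> are real scalars and commute
  with all coefficients, so the value in the complexified quaternions is multiplicative, unlike the
  left and right values. This and \<open>slice_im_mult\<close> are its two components, each obtained
  from Cauchy products.\<close>

lemma slice_re_mult: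
  assumes "f \<in> H1" "g \<in> H1" "cmod w < 1"
  shows "slice_re (f * g) w = slice_re f w * slice_re g w - slice_im f w * slice_im g w"
proof -
  have sums: "(\<lambda>k. (\<Sum>i\<le>k. (Re (w ^ i) *\<^sub>R fps_nth f i) * (Re (w ^ (k - i)) *\<^sub>R fps_nth g (k - i)))
           - (\<Sum>i\<le>k. (Im (w ^ i) *\<^sub>R fps_nth f i) * (Im (w ^ (k - i)) *\<^sub>R fps_nth g (k - i))))
        sums (slice_re f w * slice_re g w - slice_im f w * slice_im g w)"
    unfolding slice_re_def slice_im_def
    by (intro sums_diff Cauchy_product_sums[of "\<lambda>i. Re (w ^ i) *\<^sub>R fps_nth f i" "\<lambda>i. Re (w ^ i) *\<^sub>R fps_nth g i"]
        Cauchy_product_sums[of "\<lambda>i. Im (w ^ i) *\<^sub>R fps_nth f i" "\<lambda>i. Im (w ^ i) *\<^sub>R fps_nth g i"]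
        summable_slice_re summable_slice_im assms)
  have eq: "(\<lambda>k. (\<Sum>i\<le>k. (Re (w ^ i) *\<^sub>R fps_nth f i) * (Re (w ^ (k - i)) *\<^sub>R fps_nth g (k - i)))
           - (\<Sum>i\<le>k. (Im (w ^ i) *\<^sub>R fps_nth f i) * (Im (w ^ (k - i)) *\<^sub>R fps_nth g (k - i))))
     = (\<lambda>k. Re (w ^ k) *\<^sub>R fps_nth (f * g) k)"
  proof
    fix k
    have "(Re (w ^ i) *\<^sub>R fps_nth f i) * (Re (w ^ (k - i)) *\<^sub>R fps_nth g (k - i))
          - (Im (w ^ i) *\<^sub>R fps_nth f i) * (Im (w ^ (k - i)) *\<^sub>R fps_nth g (k - i))
        = Re (w ^ k) *\<^sub>R (fps_nth f i * fps_nth g (k - i))" if "i \<le> k" for i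
    proof -
      have "Re (w ^ k) = Re (w ^ i) * Re (w ^ (k - i)) - Im (w ^ i) * Im (w ^ (k - i))"
        using that by (simp only: times_complex.sel[symmetric] power_add[symmetric] le_add_diff_inverse)
      then show ?thesis
        by (simp only: mult_scaleR_left mult_scaleR_right scaleR_scaleR scaleR_diff_left mult.commute)
    qed
    then show "(\<Sum>i\<le>k. (Re (w ^ i) *\<^sub>R fps_nth f i) * (Re (w ^ (k - i)) *\<^sub>R fps_nth g (k - i)))
           - (\<Sum>i\<le>k. (Im (w ^ i) *\<^sub>R fps_nth f i) * (Im (w ^ (k - i)) *\<^sub>R fps_nth g (k - i)))
        = Re (w ^ k) *\<^sub>R fps_nth (f * g) k"
      unfolding fps_mult_nth scaleR_sum_right sum_subtractf[symmetric] atLeast0AtMost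
      by (intro sum.cong refl) simp
  qed
  show ?thesis
    by (rule sums_unique2[OF slice_re_sums[OF H1_mult[OF assms(1,2)] assms(3)] sums[unfolded eq]])
qed

lemma slice_im_mult:
  assumes "f \<in> H1" "g \<in> H1" "cmod w < 1"
  shows "slice_im (f * g) w = slice_re f w * slice_im g w + slice_im f w * slice_re g w"
proof -
  have sums: "(\<lambda>k. (\<Sum>i\<le>k. (Re (w ^ i) *\<^sub>R fps_nth f i) * (Im (w ^ (k - i)) *\<^sub>R fps_nth g (k - i)))
           + (\<Sum>i\<le>k. (Im (w ^ i) *\<^sub>R fps_nth f i) * (Re (w ^ (k - i)) *\<^sub>R fps_nth g (k - i))))
        sums (slice_re f w * slice_im g w + slice_im f w * slice_re g w)"
    unfolding slice_re_def slice_im_def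
    by (intro sums_add Cauchy_product_sums[of "\<lambda>i. Re (w ^ i) *\<^sub>R fps_nth f i" "\<lambda>i. Im (w ^ i) *\<^sub>R fps_nth g i"]
        Cauchy_product_sums[of "\<lambda>i. Im (w ^ i) *\<^sub>R fps_nth f i" "\<lambda>i. Re (w ^ i) *\<^sub>R fps_nth g i"]
        summable_slice_re summable_slice_im assms)
  have eq: "(\<lambda>k. (\<Sum>i\<le>k. (Re (w ^ i) *\<^sub>R fps_nth f i) * (Im (w ^ (k - i)) *\<^sub>R fps_nth g (k - i)))
           + (\<Sum>i\<le>k. (Im (w ^ i) *\<^sub>R fps_nth f i) * (Re (w ^ (k - i)) *\<^sub>R fps_nth g (k - i))))
     = (\<lambda>k. Im (w ^ k) *\<^sub>R fps_nth (f * g) k)"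
  proof
    fix k
    have "(Re (w ^ i) *\<^sub>R fps_nth f i) * (Im (w ^ (k - i)) *\<^sub>R fps_nth g (k - i))
          + (Im (w ^ i) *\<^sub>R fps_nth f i) * (Re (w ^ (k - i)) *\<^sub>R fps_nth g (k - i))
        = Im (w ^ k) *\<^sub>R (fps_nth f i * fps_nth g (k - i))" if "i \<le> k" for i
    proof -
      have "Im (w ^ k) = Re (w ^ i) * Im (w ^ (k - i)) + Im (w ^ i) * Re (w ^ (k - i))"
        using that by (simp only: times_complex.sel[symmetric] power_add[symmetric] le_add_diff_inverse)
      then show ?thesis
        by (simp only: mult_scaleR_left mult_scaleR_right scaleR_scaleR scaleR_add_left mult.commute)
    qed
    then show "(\<Sum>i\<le>k. (Re (w ^ i) *\<^sub>R fps_nth f i) * (Im (w ^ (k - i)) *\<^sub>R fps_nth g (k - i)))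
           + (\<Sum>i\<le>k. (Im (w ^ i) *\<^sub>R fps_nth f i) * (Re (w ^ (k - i)) *\<^sub>R fps_nth g (k - i)))
        = Im (w ^ k) *\<^sub>R fps_nth (f * g) k"
      unfolding fps_mult_nth scaleR_sum_right sum.distrib[symmetric] atLeast0AtMost
      by (intro sum.cong refl) simp
  qed
  show ?thesis
    by (rule sums_unique2[OF slice_im_sums[OF H1_mult[OF assms(1,2)] assms(3)] sums[unfolded eq]])
qed

lemma eval_fps_left_slice:
  assumes "f \<in> H1" "cmod w < 1" "imag_unit u"
  shows "eval_fps_left f (of_real (Re w) + Im w *\<^sub>R u) = slice_re f w + u * slice_im f w"
proof -
  have sums: "(\<lambda>k. Re (w ^ k) *\<^sub>R fps_nth f k + u * (Im (w ^ k) *\<^sub>R fps_nth f k))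
      sums (slice_re f w + u * slice_im f w)"
    by (intro sums_add sums_mult slice_re_sums slice_im_sums assms)
  have eq: "(\<lambda>k. Re (w ^ k) *\<^sub>R fps_nth f k + u * (Im (w ^ k) *\<^sub>R fps_nth f k))
     = (\<lambda>k. (of_real (Re w) + Im w *\<^sub>R u) ^ k * fps_nth f k)"
    unfolding quat_slice_power[OF assms(3)] by (simp add: algebra_simps of_real_def)
  show ?thesis
    using sums unfolding eq eval_fps_left_def by (simp add: sums_iff)
qed

lemma eval_fps_slice:
  assumes "f \<in> H1" "cmod w < 1" "imag_unit u"
  shows "eval_fps f (of_real (Re w) + Im w *\<^sub>R u) = slice_re f w + slice_im f w * u"
proof -
  have sums: "(\<lambda>k. Re (w ^ k) *\<^sub>R fps_nth f k + (Im (w ^ k) *\<^sub>R fps_nth f k) * u)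
      sums (slice_re f w + slice_im f w * u)"
    by (intro sums_add sums_mult2 slice_re_sums slice_im_sums assms)
  have eq: "(\<lambda>k. Re (w ^ k) *\<^sub>R fps_nth f k + (Im (w ^ k) *\<^sub>R fps_nth f k) * u)
     = (\<lambda>k. fps_nth f k * (of_real (Re w) + Im w *\<^sub>R u) ^ k)"
    unfolding quat_slice_power[OF assms(3)] by (simp add: algebra_simps of_real_def)
  show ?thesis
    using sums unfolding eq eval_fps_def by (simp add: sums_iff)
qed

text \<open>Multiplicativity of the determinant, checked in components: the imaginary part uses that
  multiplication by a fixed quaternion is a similarity, the real part uses
  \<open>inner_mult_polarization\<close>.\<close>

lemma slice_det_mult:
  assumes "f \<in> H1" "g \<in> H1" "cmod w < 1"
  shows "slice_det (f * g) w = slice_det f w * slice_det g w"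
proof -
  define a b c d where "a = slice_re f w" "b = slice_im f w" "c = slice_re g w" "d = slice_im g w"
  note * = inner_mult_polarization[of a c b d]
  have "inner (a * c - b * d) (a * d + b * c)
      = inner (a * c) (a * d) + inner (a * c) (b * c) - inner (b * d) (a * d) - inner (b * d) (b * c)"
    by (simp add: inner_diff_left inner_add_right)
  also have "\<dots> = (norm a)\<^sup>2 * inner c d + (norm c)\<^sup>2 * inner a b - (norm d)\<^sup>2 * inner a b - (norm b)\<^sup>2 * inner c d"
    by (simp add: inner_mult_left_quat inner_mult_right_quat inner_commute)
  finally have im: "inner (a * c - b * d) (a * d + b * c) = \<dots>" .
  have re: "(norm (a * c - b * d))\<^sup>2 - (norm (a * d + b * c))\<^sup>2
      = ((norm a)\<^sup>2 - (norm b)\<^sup>2) * ((norm c)\<^sup>2 - (norm d)\<^sup>2) - (2 * inner a b) * (2 * inner c d)"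
    using * norm_add_power2[of "a * c" "- (b * d)"] norm_add_power2[of "a * d" "b * c"]
    by (simp add: norm_mult power_mult_distrib algebra_simps)
  show ?thesis
    unfolding slice_det_def slice_re_mult[OF assms] slice_im_mult[OF assms]
      a_b_c_d_def[symmetric] complex_eq_iff times_complex.sel complex.sel re im
    by (simp add: algebra_simps)
qed

text \<open>The gap is four times the Gram determinant of \<open>slice_re\<close> and
  \<open>slice_im\<close>, the same quantity that appears in \<open>lagrange_left\<close> and
  \<open>lagrange_right\<close>.\<close>

lemma cmod_slice_det_sq:
  "(cmod (slice_det f w))\<^sup>2 = (slice_sq f w)\<^sup>2 - 4 * ((norm (slice_re f w))\<^sup>2 * (norm (slice_im f w))\<^sup>2
      - (inner (slice_re f w) (slice_im f w))\<^sup>2)"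
  unfolding cmod_power2 slice_det_def slice_sq_def complex.sel
  by (simp add: algebra_simps power2_eq_square)

lemma cmod_slice_det_le: "cmod (slice_det f w) \<le> slice_sq f w"
proof (rule power2_le_imp_le)
  have "(inner (slice_re f w) (slice_im f w))\<^sup>2 \<le> (norm (slice_re f w))\<^sup>2 * (norm (slice_im f w))\<^sup>2"
    using Cauchy_Schwarz_ineq[of "slice_re f w" "slice_im f w"] by (simp add: power2_norm_eq_inner)
  then show "(cmod (slice_det f w))\<^sup>2 \<le> (slice_sq f w)\<^sup>2"
    by (simp add: cmod_slice_det_sq)
qed (simp add: slice_sq_def)

section \<open>Boundary behaviour\<close>

text \<open>Pulling back along the modulus makes every limit uniform in the argument of
  \<open>w\<close>.\<close>

definition to_unit_circle :: "complex filter" where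
  "to_unit_circle = filtercomap cmod (at_left 1)"

text \<open>If the mean of the squares and the product of two singular values both tend to 1, both
  singular values tend to 1. No inverse or adjoint has to be mentioned in this form.\<close>

definition boundary_unitary :: "quat fps \<Rightarrow> bool" where
  "boundary_unitary f \<longleftrightarrow> (slice_sq f \<longlongrightarrow> 1) to_unit_circle \<and>
     ((\<lambda>w. cmod (slice_det f w)) \<longlongrightarrow> 1) to_unit_circle"

lemma eventually_at_left_1_interval: "eventually (\<lambda>x. 0 < x \<and> x < 1) (at_left (1::real))"
  using eventually_at_left[of "0::real" 1] by (auto intro!: exI[of _ 0])

lemma eventually_cmod_less_1: "eventually (\<lambda>w. cmod w < 1) to_unit_circle"
  unfolding to_unit_circle_def
  using eventually_at_left_1_interval
  by (intro eventually_filtercomapI[where P = "\<lambda>x. x < 1"]) (auto elim: eventually_mono)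

lemma cmod_tendsto_1: "(cmod \<longlongrightarrow> 1) to_unit_circle"
  unfolding to_unit_circle_def
  by (rule filterlim_mono[OF filterlim_filtercomap _ order_refl]) (simp add: at_within_def)

lemma filterlim_slice:
  assumes "imag_unit u"
  shows "filterlim (\<lambda>w. of_real (Re w) + Im w *\<^sub>R u) to_unit_sphere to_unit_circle"
  unfolding to_unit_sphere_def to_unit_circle_def filterlim_filtercomap_iff comp_def
    norm_quat_slice[OF assms]
  by (rule filterlim_filtercomap)

text \<open>Both filters see only the modulus, and by \<open>quat_polar\<close> every point of the
  ball lies on some slice. An estimate valid for all units \<open>u\<close> at once therefore passes
  to the sphere filter.\<close>

lemma eventually_to_unit_sphereI:
  assumes "eventually P to_unit_circle"
    and "\<And>w u. cmod w < 1 \<Longrightarrow> imag_unit u \<Longrightarrow> P w \<Longrightarrow> R (of_real (Re w) + Im w *\<^sub>R u)"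
  shows "eventually R to_unit_sphere"
proof -
  obtain Q where Q: "eventually Q (at_left 1)" "\<And>w. Q (cmod w) \<Longrightarrow> P w"
    using assms(1) unfolding to_unit_circle_def eventually_filtercomap by blast
  have "R \<gamma>" if "Q (norm \<gamma>)" "norm \<gamma> < 1" for \<gamma>
  proof -
    obtain w u where "imag_unit u" "\<gamma> = of_real (Re w) + Im w *\<^sub>R u" by (rule quat_polar)
    with that Q(2) assms(2) norm_quat_slice show ?thesis by metis
  qed
  moreover have "eventually (\<lambda>x. Q x \<and> x < 1) (at_left 1)"
    using Q(1) eventually_at_left_1_interval by eventually_elim simp
  ultimately show ?thesis
    unfolding to_unit_sphere_def eventually_filtercomap by blast
qed

text \<open>The square root is the maximum of twice the inner product of \<open>slice_re f w\<close>
  with \<open>u * slice_im f w\<close> over all imaginary units \<open>u\<close>. The sum thus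
  bounds the distance from 1 of the squared modulus of every left or right value over
  \<open>w\<close>, uniformly in the unit.\<close>

definition slice_defect :: "quat fps \<Rightarrow> complex \<Rightarrow> real" where
  "slice_defect f w = \<bar>slice_sq f w - 1\<bar> + sqrt ((slice_sq f w)\<^sup>2 - (cmod (slice_det f w))\<^sup>2)"

lemma slice_defect_tendsto:
  assumes "boundary_unitary f"
  shows "(slice_defect f \<longlongrightarrow> 0) to_unit_circle"
proof -
  have "((\<lambda>w. \<bar>slice_sq f w - 1\<bar> + sqrt ((slice_sq f w)\<^sup>2 - (cmod (slice_det f w))\<^sup>2)) \<longlongrightarrow>
      \<bar>1 - 1\<bar> + sqrt (1\<^sup>2 - 1\<^sup>2)) to_unit_circle"
    using assms unfolding boundary_unitary_def by (intro tendsto_intros) auto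
  then show ?thesis by (simp add: slice_defect_def[abs_def])
qed

lemma slice_defect_ge:
  assumes "(inner (slice_re f w) v)\<^sup>2
    \<le> (norm (slice_re f w))\<^sup>2 * (norm (slice_im f w))\<^sup>2 - (inner (slice_re f w) (slice_im f w))\<^sup>2"
    and "x = slice_sq f w + 2 * inner (slice_re f w) v"
  shows "\<bar>x - 1\<bar> \<le> slice_defect f w"
proof -
  have "(2 * \<bar>inner (slice_re f w) v\<bar>)\<^sup>2 \<le> (slice_sq f w)\<^sup>2 - (cmod (slice_det f w))\<^sup>2"
    using assms(1) by (simp add: cmod_slice_det_sq power_mult_distrib)
  then have "2 * \<bar>inner (slice_re f w) v\<bar> \<le> sqrt ((slice_sq f w)\<^sup>2 - (cmod (slice_det f w))\<^sup>2)"
    by (rule real_le_rsqrt)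
  then show ?thesis unfolding assms(2) slice_defect_def by linarith
qed

lemma left_value_defect:
  assumes "imag_unit u"
  shows "\<bar>(norm (slice_re f w + u * slice_im f w))\<^sup>2 - 1\<bar> \<le> slice_defect f w"
  by (rule slice_defect_ge[OF inner_imag_unit_left_le[OF assms]])
    (simp add: norm_add_imag_unit_mult[OF assms] slice_sq_def)

lemma right_value_defect:
  assumes "imag_unit u"
  shows "\<bar>(norm (slice_re f w + slice_im f w * u))\<^sup>2 - 1\<bar> \<le> slice_defect f w"
  by (rule slice_defect_ge[OF inner_imag_unit_right_le[OF assms]])
    (simp add: norm_add_mult_imag_unit[OF assms] slice_sq_def)

lemma tendsto_norm_of_defect:
  assumes "boundary_unitary f"
    and "\<And>w u. cmod w < 1 \<Longrightarrow> imag_unit u \<Longrightarrow>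
      \<bar>(norm (h (of_real (Re w) + Im w *\<^sub>R u)))\<^sup>2 - 1\<bar> \<le> slice_defect f w"
  shows "((\<lambda>\<gamma>. norm (h \<gamma>)) \<longlongrightarrow> 1) to_unit_sphere"
proof -
  have "((\<lambda>\<gamma>. (norm (h \<gamma>))\<^sup>2) \<longlongrightarrow> 1) to_unit_sphere"
  proof (rule tendstoI)
    fix e :: real assume "e > 0"
    from tendstoD[OF slice_defect_tendsto[OF assms(1)] this]
    have ev: "eventually (\<lambda>w. slice_defect f w < e) to_unit_circle"
      by (rule eventually_mono) (simp add: dist_real_def)
    show "eventually (\<lambda>\<gamma>. dist ((norm (h \<gamma>))\<^sup>2) 1 < e) to_unit_sphere"
      by (rule eventually_to_unit_sphereI[OF ev])
        (use assms(2) in \<open>force simp: dist_real_def intro: le_less_trans\<close>)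
  qed
  from tendsto_real_sqrt[OF this] show ?thesis by simp
qed

lemma boundary_unitary_left:
  assumes "f \<in> H1" "boundary_unitary f"
  shows "((\<lambda>\<gamma>. norm (eval_fps_left f \<gamma>)) \<longlongrightarrow> 1) to_unit_sphere"
  by (rule tendsto_norm_of_defect[OF assms(2)])
    (simp add: eval_fps_left_slice[OF assms(1)] left_value_defect)

lemma boundary_unitary_right:
  assumes "f \<in> H1" "boundary_unitary f"
  shows "((\<lambda>\<gamma>. norm (eval_fps f \<gamma>)) \<longlongrightarrow> 1) to_unit_sphere"
  by (rule tendsto_norm_of_defect[OF assms(2)])
    (simp add: eval_fps_slice[OF assms(1)] right_value_defect)

text \<open>The values at \<open>u\<close> and \<open>- u\<close> determine \<open>slice_sq\<close> and the inner product of \<open>slice_re\<close> with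
  \<open>u * slice_im\<close>; for the three coordinate units the squares of these inner products add up to
  \<open>(slice_sq\<^sup>2 - |slice_det|\<^sup>2) / 4\<close>.\<close>

lemma boundary_unitaryI_left:
  assumes "\<And>u. imag_unit u \<Longrightarrow>
    ((\<lambda>w. (norm (slice_re f w + u * slice_im f w))\<^sup>2) \<longlongrightarrow> 1) to_unit_circle"
  shows "boundary_unitary f"
proof -
  let ?i = "\<lambda>u w. inner (slice_re f w) (u * slice_im f w)"
  have "((\<lambda>w. ((norm (slice_re f w + u * slice_im f w))\<^sup>2
      + (norm (slice_re f w + - u * slice_im f w))\<^sup>2) / 2) \<longlongrightarrow> (1 + 1) / 2) to_unit_circle"
    if "imag_unit u" for u
    by (intro tendsto_intros assms imag_unit_uminus that) simp
  from this[OF imag_unit_axes(1)] have sq: "(slice_sq f \<longlongrightarrow> 1) to_unit_circle"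
    by (simp only: norm_add_imag_unit_mult imag_unit_axes imag_unit_uminus)
      (simp add: slice_sq_def[abs_def] add_divide_distrib)
  have "((\<lambda>w. ((norm (slice_re f w + u * slice_im f w))\<^sup>2
      - (norm (slice_re f w + - u * slice_im f w))\<^sup>2) / 4) \<longlongrightarrow> (1 - 1) / 4) to_unit_circle"
    if "imag_unit u" for u
    by (intro tendsto_intros assms imag_unit_uminus that) simp
  from this have i: "(?i u \<longlongrightarrow> 0) to_unit_circle" if "imag_unit u" for u
    using that by (simp only: norm_add_imag_unit_mult imag_unit_uminus) simp
  have "((\<lambda>w. sqrt ((slice_sq f w)\<^sup>2 - 4 * ((?i (Quat 0 1 0 0) w)\<^sup>2 + (?i (Quat 0 0 1 0) w)\<^sup>2
      + (?i (Quat 0 0 0 1) w)\<^sup>2))) \<longlongrightarrow> sqrt (1\<^sup>2 - 4 * (0\<^sup>2 + 0\<^sup>2 + 0\<^sup>2))) to_unit_circle"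
    by (intro tendsto_intros sq i imag_unit_axes)
  then have "((\<lambda>w. cmod (slice_det f w)) \<longlongrightarrow> 1) to_unit_circle"
    unfolding lagrange_left cmod_slice_det_sq[symmetric] by simp
  with sq show ?thesis by (simp add: boundary_unitary_def)
qed

lemma boundary_unitaryI_right:
  assumes "\<And>u. imag_unit u \<Longrightarrow>
    ((\<lambda>w. (norm (slice_re f w + slice_im f w * u))\<^sup>2) \<longlongrightarrow> 1) to_unit_circle"
  shows "boundary_unitary f"
proof -
  let ?i = "\<lambda>u w. inner (slice_re f w) (slice_im f w * u)"
  have "((\<lambda>w. ((norm (slice_re f w + slice_im f w * u))\<^sup>2
      + (norm (slice_re f w + slice_im f w * - u))\<^sup>2) / 2) \<longlongrightarrow> (1 + 1) / 2) to_unit_circle"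
    if "imag_unit u" for u
    by (intro tendsto_intros assms imag_unit_uminus that) simp
  from this[OF imag_unit_axes(1)] have sq: "(slice_sq f \<longlongrightarrow> 1) to_unit_circle"
    by (simp only: norm_add_mult_imag_unit imag_unit_axes imag_unit_uminus)
      (simp add: slice_sq_def[abs_def] add_divide_distrib)
  have "((\<lambda>w. ((norm (slice_re f w + slice_im f w * u))\<^sup>2
      - (norm (slice_re f w + slice_im f w * - u))\<^sup>2) / 4) \<longlongrightarrow> (1 - 1) / 4) to_unit_circle"
    if "imag_unit u" for u
    by (intro tendsto_intros assms imag_unit_uminus that) simp
  from this have i: "(?i u \<longlongrightarrow> 0) to_unit_circle" if "imag_unit u" for u
    using that by (simp only: norm_add_mult_imag_unit imag_unit_uminus) simp
  have "((\<lambda>w. sqrt ((slice_sq f w)\<^sup>2 - 4 * ((?i (Quat 0 1 0 0) w)\<^sup>2 + (?i (Quat 0 0 1 0) w)\<^sup>2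
      + (?i (Quat 0 0 0 1) w)\<^sup>2))) \<longlongrightarrow> sqrt (1\<^sup>2 - 4 * (0\<^sup>2 + 0\<^sup>2 + 0\<^sup>2))) to_unit_circle"
    by (intro tendsto_intros sq i imag_unit_axes)
  then have "((\<lambda>w. cmod (slice_det f w)) \<longlongrightarrow> 1) to_unit_circle"
    unfolding lagrange_right cmod_slice_det_sq[symmetric] by simp
  with sq show ?thesis by (simp add: boundary_unitary_def)
qed

lemma boundary_unitary_iff_left:
  assumes "f \<in> H1"
  shows "boundary_unitary f \<longleftrightarrow> ((\<lambda>\<gamma>. norm (eval_fps_left f \<gamma>)) \<longlongrightarrow> 1) to_unit_sphere"
proof
  assume lim: "((\<lambda>\<gamma>. norm (eval_fps_left f \<gamma>)) \<longlongrightarrow> 1) to_unit_sphere"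
  show "boundary_unitary f"
  proof (rule boundary_unitaryI_left)
    fix u assume u: "imag_unit u"
    have "((\<lambda>w. (norm (eval_fps_left f (of_real (Re w) + Im w *\<^sub>R u)))\<^sup>2) \<longlongrightarrow> 1\<^sup>2) to_unit_circle"
      by (intro tendsto_power filterlim_compose[OF lim filterlim_slice[OF u]])
    moreover have "eventually (\<lambda>w. (norm (eval_fps_left f (of_real (Re w) + Im w *\<^sub>R u)))\<^sup>2
        = (norm (slice_re f w + u * slice_im f w))\<^sup>2) to_unit_circle"
      using eventually_cmod_less_1 by eventually_elim (simp add: eval_fps_left_slice assms u)
    ultimately show "((\<lambda>w. (norm (slice_re f w + u * slice_im f w))\<^sup>2) \<longlongrightarrow> 1) to_unit_circle"
      by (simp add: tendsto_cong)
  qed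
qed (rule boundary_unitary_left[OF assms])

lemma boundary_unitary_iff_right:
  assumes "f \<in> H1"
  shows "boundary_unitary f \<longleftrightarrow> ((\<lambda>\<gamma>. norm (eval_fps f \<gamma>)) \<longlongrightarrow> 1) to_unit_sphere"
proof
  assume lim: "((\<lambda>\<gamma>. norm (eval_fps f \<gamma>)) \<longlongrightarrow> 1) to_unit_sphere"
  show "boundary_unitary f"
  proof (rule boundary_unitaryI_right)
    fix u assume u: "imag_unit u"
    have "((\<lambda>w. (norm (eval_fps f (of_real (Re w) + Im w *\<^sub>R u)))\<^sup>2) \<longlongrightarrow> 1\<^sup>2) to_unit_circle"
      by (intro tendsto_power filterlim_compose[OF lim filterlim_slice[OF u]])
    moreover have "eventually (\<lambda>w. (norm (eval_fps f (of_real (Re w) + Im w *\<^sub>R u)))\<^sup>2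
        = (norm (slice_re f w + slice_im f w * u))\<^sup>2) to_unit_circle"
      using eventually_cmod_less_1 by eventually_elim (simp add: eval_fps_slice assms u)
    ultimately show "((\<lambda>w. (norm (slice_re f w + slice_im f w * u))\<^sup>2) \<longlongrightarrow> 1) to_unit_circle"
      by (simp add: tendsto_cong)
  qed
qed (rule boundary_unitary_right[OF assms])

text \<open>If c is the left value of \<open>f\<close> at a point, the left value of
  \<open>f * g\<close> there is c times the left value of \<open>g\<close> at the point conjugated
  by c. The conjugated point stays over the same \<open>w\<close>, and the defect of
  \<open>g\<close> controls all units.\<close>

lemma boundary_unitary_mult:
  assumes f: "f \<in> H1" "boundary_unitary f" and g: "g \<in> H1" "boundary_unitary g"
  shows "boundary_unitary (f * g)"
proof (rule boundary_unitaryI_left)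
  fix u assume u: "imag_unit u"
  let ?c = "\<lambda>w. slice_re f w + u * slice_im f w"
  \<comment> \<open>Where the value of \<open>f\<close> vanishes both sides of the product formula
    are 0, and any imaginary unit will do.\<close>
  let ?v = "\<lambda>w. if ?c w = 0 then u else inverse (?c w) * u * ?c w"
  have v: "imag_unit (?v w)" for w
    using u imag_unit_conj by simp
  \<comment> \<open>The unit may vary with \<open>w\<close>, because \<open>slice_defect\<close>
    does not depend on it.\<close>
  have lim1: "((\<lambda>w. (norm (slice_re h w + v w * slice_im h w))\<^sup>2) \<longlongrightarrow> 1) to_unit_circle"
    if "boundary_unitary h" "\<And>w. imag_unit (v w)" for h v
  proof (rule tendsto_0_le[OF slice_defect_tendsto[OF that(1)], of _ 1, THEN LIM_zero_cancel])
    show "eventually (\<lambda>w. norm ((norm (slice_re h w + v w * slice_im h w))\<^sup>2 - 1) \<le> norm (slice_defect h w) * 1) to_unit_circle"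
      by (intro always_eventually allI) (simp add: order_trans[OF left_value_defect[OF that(2)] abs_ge_self])
  qed
  have "((\<lambda>w. (norm (?c w))\<^sup>2 * (norm (slice_re g w + ?v w * slice_im g w))\<^sup>2) \<longlongrightarrow> 1 * 1) to_unit_circle"
    by (intro tendsto_mult lim1 f g u v)
  moreover have "eventually (\<lambda>w. (norm (?c w))\<^sup>2 * (norm (slice_re g w + ?v w * slice_im g w))\<^sup>2
      = (norm (slice_re (f * g) w + u * slice_im (f * g) w))\<^sup>2) to_unit_circle"
    using eventually_cmod_less_1
  proof eventually_elim
    case (elim w)
    have "u * (u * x) = - x" for x
      using imag_unit_square[OF u] by (simp flip: mult.assoc)
    then have "slice_re (f * g) w + u * slice_im (f * g) w
        = ?c w * slice_re g w + u * ?c w * slice_im g w"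
      unfolding slice_re_mult[OF f(1) g(1) elim] slice_im_mult[OF f(1) g(1) elim]
      by (simp add: algebra_simps)
    also have "\<dots> = ?c w * (slice_re g w + ?v w * slice_im g w)"
    proof (cases "?c w = 0")
      case False
      have "c * a + u * c * b = c * (a + inverse c * u * c * b)" if "c \<noteq> 0" for a b c :: quat
        using that by (simp add: distrib_left mult.assoc[symmetric])
      from this[OF False] False show ?thesis by (simp only: if_False)
    qed simp
    finally show ?case by (simp add: norm_mult power_mult_distrib)
  qed
  ultimately show "((\<lambda>w. (norm (slice_re (f * g) w + u * slice_im (f * g) w))\<^sup>2) \<longlongrightarrow> 1) to_unit_circle"
    by (simp add: tendsto_cong)
qed

section \<open>Conjugation and real coefficients\<close>

definition fps_qcnj :: "quat fps \<Rightarrow> quat fps" where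
  "fps_qcnj f = Abs_fps (\<lambda>k. qcnj (fps_nth f k))"

text \<open>The target algebra is left open so that one real series can act both as a central
  quaternionic factor and as a holomorphic function.\<close>

definition of_real_fps :: "real fps \<Rightarrow> 'a :: real_algebra_1 fps" where
  "of_real_fps p = Abs_fps (\<lambda>k. of_real (fps_nth p k))"

text \<open>The symmetrization of \<open>f\<close>. Taking real parts discards nothing, since
  \<open>f * fps_qcnj f\<close> has real coefficients by \<open>mult_fps_qcnj\<close>.\<close>

definition norm_fps :: "quat fps \<Rightarrow> real fps" where
  "norm_fps f = Abs_fps (\<lambda>k. qre (fps_nth (f * fps_qcnj f) k))"

lemma fps_qcnj_nth [simp]: "fps_nth (fps_qcnj f) k = qcnj (fps_nth f k)"
  by (simp add: fps_qcnj_def)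

lemma fps_qcnj_in_H1: "f \<in> H1 \<Longrightarrow> fps_qcnj f \<in> H1"
  by (simp add: H1_def)

lemma slice_re_qcnj:
  assumes "f \<in> H1" "cmod w < 1"
  shows "slice_re (fps_qcnj f) w = qcnj (slice_re f w)"
  using bounded_linear.sums[OF bounded_linear_qcnj slice_re_sums[OF assms]]
  by (simp add: slice_re_def qcnj_scaleR sums_iff)

lemma slice_im_qcnj:
  assumes "f \<in> H1" "cmod w < 1"
  shows "slice_im (fps_qcnj f) w = qcnj (slice_im f w)"
  using bounded_linear.sums[OF bounded_linear_qcnj slice_im_sums[OF assms]]
  by (simp add: slice_im_def qcnj_scaleR sums_iff)

lemma slice_sq_qcnj: "f \<in> H1 \<Longrightarrow> cmod w < 1 \<Longrightarrow> slice_sq (fps_qcnj f) w = slice_sq f w"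
  by (simp add: slice_sq_def slice_re_qcnj slice_im_qcnj)

lemma slice_det_qcnj: "f \<in> H1 \<Longrightarrow> cmod w < 1 \<Longrightarrow> slice_det (fps_qcnj f) w = slice_det f w"
  by (simp add: slice_det_def slice_re_qcnj slice_im_qcnj)

lemma boundary_unitary_cong:
  assumes "\<And>w. cmod w < 1 \<Longrightarrow> slice_sq f w = slice_sq g w"
    and "\<And>w. cmod w < 1 \<Longrightarrow> cmod (slice_det f w) = cmod (slice_det g w)"
  shows "boundary_unitary f \<longleftrightarrow> boundary_unitary g"
  unfolding boundary_unitary_def
  by (intro arg_cong2[where f = "(\<and>)"] tendsto_cong eventually_mono[OF eventually_cmod_less_1] assms)

lemma boundary_unitary_qcnj: "f \<in> H1 \<Longrightarrow> boundary_unitary (fps_qcnj f) \<longleftrightarrow> boundary_unitary f"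
  by (rule boundary_unitary_cong) (simp_all add: slice_sq_qcnj slice_det_qcnj)

section \<open>Series with real coefficients and the norm series\<close>

lemma of_real_fps_nth [simp]: "fps_nth (of_real_fps p) k = of_real (fps_nth p k)"
  by (simp add: of_real_fps_def)

lemma of_real_fps_mult: "of_real_fps (p * q) = of_real_fps p * of_real_fps q"
  by (simp add: fps_eq_iff fps_mult_nth)

lemma of_real_fps_1: "of_real_fps 1 = 1"
  by (simp add: fps_eq_iff)

lemma of_real_fps_inverse:
  assumes "fps_nth p 0 \<noteq> 0"
  shows "of_real_fps p * of_real_fps (inverse p) = 1"
  using assms by (simp flip: of_real_fps_mult add: of_real_fps_1 mult.commute[of p] inverse_mult_eq_1)

lemma fps_conv_radius_of_real_fps:
  "fps_conv_radius (of_real_fps p :: 'a :: {banach, real_normed_div_algebra} fps) = fps_conv_radius p"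
  by (simp add: fps_conv_radius_def conv_radius_def)

lemma of_real_fps_in_H1:
  "of_real_fps p \<in> H1 \<longleftrightarrow> 1 \<le> fps_conv_radius (of_real_fps p :: complex fps)"
  by (simp add: H1_iff fps_conv_radius_of_real_fps)

lemma of_real_fps_commute: "of_real_fps p * f = f * of_real_fps p" for f :: "'a :: real_algebra_1 fps"
proof (rule fps_ext)
  fix k
  have "fps_nth (of_real_fps p * f) k = (\<Sum>i=0..k. fps_nth f (k - i) * of_real (fps_nth p i))"
    by (simp add: fps_mult_nth scaleR_conv_of_real[symmetric] of_real_def)
  also have "\<dots> = fps_nth (f * of_real_fps p) k"
    unfolding fps_mult_nth by (rule sum.reindex_bij_witness[of _ "\<lambda>i. k - i" "\<lambda>i. k - i"]) auto
  finally show "fps_nth (of_real_fps p * f) k = fps_nth (f * of_real_fps p) k" .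
qed

lemma slice_of_real_fps:
  assumes "of_real_fps p \<in> H1" "cmod w < 1"
  shows "slice_re (of_real_fps p) w = of_real (Re (eval_fps (of_real_fps p) w))"
    and "slice_im (of_real_fps p) w = of_real (Im (eval_fps (of_real_fps p) w))"
proof -
  have "ereal (cmod w) < fps_conv_radius (of_real_fps p :: complex fps)"
    using assms by (intro less_le_trans[OF _ assms(1)[unfolded of_real_fps_in_H1]]) simp
  from sums_eval_fps[OF this]
  have *: "(\<lambda>k. of_real (fps_nth p k) * w ^ k) sums eval_fps (of_real_fps p) w" by simp
  have "(\<lambda>k. Re (w ^ k) *\<^sub>R fps_nth (of_real_fps p) k)
      = (\<lambda>k. of_real (Re (of_real (fps_nth p k) * w ^ k)) :: quat)"
    "(\<lambda>k. Im (w ^ k) *\<^sub>R fps_nth (of_real_fps p) k)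
      = (\<lambda>k. of_real (Im (of_real (fps_nth p k) * w ^ k)) :: quat)"
    by (simp_all add: of_real_def mult.commute)
  with sums_of_real[OF sums_Re[OF *], where 'a = quat] sums_of_real[OF sums_Im[OF *], where 'a = quat]
  show "slice_re (of_real_fps p) w = of_real (Re (eval_fps (of_real_fps p) w))"
    and "slice_im (of_real_fps p) w = of_real (Im (eval_fps (of_real_fps p) w))"
    unfolding slice_re_def slice_im_def by (simp_all only: sums_iff)
qed

text \<open>A real series takes complex scalar values on the slices, and multiplying A + iB by a
  scalar multiplies \<open>slice_sq\<close> by its squared modulus.\<close>

lemma slice_sq_mult_of_real_fps:
  assumes "f \<in> H1" "of_real_fps p \<in> H1" "cmod w < 1"
  shows "slice_sq (f * of_real_fps p) w = slice_sq f w * (cmod (eval_fps (of_real_fps p) w))\<^sup>2"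
  unfolding slice_sq_def slice_re_mult[OF assms] slice_im_mult[OF assms]
    slice_of_real_fps[OF assms(2,3)] cmod_power2 norm_quat_power2
  by (simp add: of_real_def algebra_simps power2_eq_square)

text \<open>Conjugating a coefficient of the product and reversing the order of summation gives the
  same coefficient back, so it is real.\<close>

lemma mult_fps_qcnj: "f * fps_qcnj f = of_real_fps (norm_fps f)"
proof (rule fps_ext)
  fix k
  let ?c = "fps_nth (f * fps_qcnj f) k"
  have "qcnj ?c = (\<Sum>i=0..k. fps_nth f (k - i) * qcnj (fps_nth f i))"
    by (simp add: fps_mult_nth qcnj_sum qcnj_mult)
  also have "\<dots> = ?c"
    unfolding fps_mult_nth by (rule sum.reindex_bij_witness[of _ "\<lambda>i. k - i" "\<lambda>i. k - i"]) auto
  finally have "?c = of_real (qre ?c)"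
    by (simp add: quat_eq_iff of_real_def)
  then show "?c = fps_nth (of_real_fps (norm_fps f)) k"
    by (simp add: norm_fps_def)
qed

lemma norm_fps_in_H1: "f \<in> H1 \<Longrightarrow> of_real_fps (norm_fps f) \<in> H1"
  unfolding mult_fps_qcnj[symmetric] by (intro H1_mult fps_qcnj_in_H1)

text \<open>This exhibits \<open>slice_det f\<close> as the sum of an ordinary complex power series,
  which makes the theory of holomorphic functions available.\<close>

lemma eval_norm_fps:
  assumes "f \<in> H1" "cmod w < 1"
  shows "eval_fps (of_real_fps (norm_fps f)) w = slice_det f w"
proof -
  have "slice_re (f * fps_qcnj f) w = of_real (Re (slice_det f w))"
    "slice_im (f * fps_qcnj f) w = of_real (Im (slice_det f w))"
    unfolding slice_re_mult[OF assms(1) fps_qcnj_in_H1[OF assms(1)] assms(2)]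
      slice_im_mult[OF assms(1) fps_qcnj_in_H1[OF assms(1)] assms(2)]
      slice_re_qcnj[OF assms] slice_im_qcnj[OF assms]
    by (simp_all add: slice_det_def quat_mult_qcnj quat_eq_iff inner_quat_def of_real_def)
  then show ?thesis
    unfolding mult_fps_qcnj slice_of_real_fps[OF norm_fps_in_H1[OF assms(1)] assms(2)]
    by (simp add: complex_eq_iff)
qed

lemma slice_zero: "slice_re f 0 = fps_nth f 0" "slice_im f 0 = 0"
proof -
  have "Re (0 ^ k) *\<^sub>R fps_nth f k = (if k = 0 then fps_nth f k else 0)" for k
    by (cases k) auto
  then show "slice_re f 0 = fps_nth f 0"
    unfolding slice_re_def by (subst suminf_finite[of "{0}"]) simp_all
  have "Im (0 ^ k) *\<^sub>R fps_nth f k = 0" for k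
    by (cases k) auto
  then show "slice_im f 0 = 0" unfolding slice_im_def by simp
qed

text \<open>The inverse is given by the adjugate formula: \<open>fps_qcnj f\<close> times the
  reciprocal of the norm series. The norm series has no zeros in the disc, so its reciprocal again
  has radius of convergence at least 1.\<close>

lemma inverse_in_H1:
  assumes f: "f \<in> H1" and nz: "\<And>w. cmod w < 1 \<Longrightarrow> slice_det f w \<noteq> 0"
  obtains g where "g \<in> H1" "f * g = 1"
    "\<And>w. cmod w < 1 \<Longrightarrow> slice_sq g w = slice_sq f w / (cmod (slice_det f w))\<^sup>2"
proof -
  define p where "p = norm_fps f"
  let ?P = "of_real_fps p :: complex fps"
  have ev: "eval_fps ?P w = slice_det f w" if "cmod w < 1" for w
    unfolding p_def by (rule eval_norm_fps[OF f that])
  have rad: "1 \<le> fps_conv_radius ?P"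
    using norm_fps_in_H1[OF f] by (simp add: of_real_fps_in_H1 p_def)
  have nz': "eval_fps ?P w \<noteq> 0" if "ereal (cmod w) < 1" for w
    using nz ev that by simp
  have "fps_nth ?P 0 \<noteq> 0"
    using nz'[of 0] by (simp add: eval_fps_at_0)
  then have p0: "fps_nth p 0 \<noteq> 0" by simp
  have inv: "of_real_fps (inverse p) = inverse ?P"
    using of_real_fps_inverse[OF p0, where 'a = complex] by (metis fps_inverse_unique)
  have "1 \<le> fps_conv_radius (inverse ?P)"
    using fps_conv_radius_inverse[of 1 ?P] nz' rad by (simp add: min_def split: if_splits)
  then have q: "of_real_fps (inverse p) \<in> H1"
    by (simp add: of_real_fps_in_H1 inv)
  show thesis
  proof
    show "fps_qcnj f * of_real_fps (inverse p) \<in> H1"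
      by (intro H1_mult fps_qcnj_in_H1 f q)
    show "f * (fps_qcnj f * of_real_fps (inverse p)) = 1"
      by (simp add: mult.assoc[symmetric] mult_fps_qcnj p_def[symmetric] of_real_fps_inverse p0)
    fix w assume w: "cmod w < 1"
    have "ereal (cmod w) < fps_conv_radius ?P"
      using w by (intro less_le_trans[OF _ rad]) simp
    then have "eval_fps (inverse ?P) w = inverse (slice_det f w)"
      using eval_fps_inverse[of 1 ?P w] nz' w ev by simp
    then show "slice_sq (fps_qcnj f * of_real_fps (inverse p)) w = slice_sq f w / (cmod (slice_det f w))\<^sup>2"
      by (simp add: slice_sq_mult_of_real_fps[OF fps_qcnj_in_H1[OF f] q w] inv slice_sq_qcnj[OF f w]
          norm_inverse power_inverse divide_inverse)
  qed
qed

section \<open>Coefficient bounds\<close>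

text \<open>Cauchy's inequality is applied to the scalar series \<open>G\<close> obtained by pairing
  all coefficients with \<open>c\<close>, the coefficient to be bounded. The \<open>k\<close>-th
  coefficient of \<open>G\<close> is |c|^2, while |G| is at most |c| M on the circle, and one factor
  |c| cancels.\<close>

lemma norm_coeff_le:
  assumes f: "f \<in> H1" and r: "0 < r" "r < 1"
    and M: "0 \<le> M" "\<And>w. cmod w = r \<Longrightarrow> slice_sq f w \<le> M\<^sup>2"
  shows "norm (fps_nth f k) * r ^ k \<le> M"
proof -
  define c where "c = fps_nth f k"
  define G :: "complex fps" where "G = Abs_fps (\<lambda>n. of_real (inner (fps_nth f n) c))"
  have "conv_radius (fps_nth G) \<ge> 1"
  proof (rule conv_radius_geI_ex')
    fix s :: real assume s: "0 < s" "ereal s < 1"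
    then have "summable (\<lambda>n. norm (fps_nth f n) * s ^ n * norm c)"
      using f by (intro summable_mult2) (simp add: H1_iff_summable)
    then show "summable (\<lambda>n. fps_nth G n * of_real s ^ n)"
    proof (rule summable_comparison_test'[where N = 0])
      fix n
      have "\<bar>inner (fps_nth f n) c\<bar> * s ^ n \<le> norm (fps_nth f n) * norm c * s ^ n"
        using s by (intro mult_right_mono Cauchy_Schwarz_ineq2) simp
      then show "norm (fps_nth G n * of_real s ^ n) \<le> norm (fps_nth f n) * s ^ n * norm c"
        using s by (simp add: G_def norm_mult norm_power mult.commute mult.left_commute)
    qed
  qed
  then have rad: "1 \<le> fps_conv_radius G" by (simp add: fps_conv_radius_def)
  have sub: "cball (0 :: complex) r \<subseteq> eball 0 (fps_conv_radius G)"
  proof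
    fix w :: complex assume "w \<in> cball 0 r"
    then have "ereal (cmod w) < 1" using r by simp
    then have "ereal (cmod w) < fps_conv_radius G" by (rule less_le_trans[OF _ rad])
    then show "w \<in> eball 0 (fps_conv_radius G)" by simp
  qed
  have bound: "cmod (eval_fps G w) \<le> norm c * M" if w: "cmod w = r" for w
  proof -
    have w1: "cmod w < 1" using w r by simp
    have "(\<lambda>n. fps_nth G n * w ^ n) sums eval_fps G w"
      using w1 by (intro sums_eval_fps less_le_trans[OF _ rad]) simp
    then have "(\<lambda>n. inner (fps_nth f n) c * Re (w ^ n)) sums Re (eval_fps G w)"
      "(\<lambda>n. inner (fps_nth f n) c * Im (w ^ n)) sums Im (eval_fps G w)"
      by (auto simp: G_def dest: sums_Re sums_Im)
    moreover have "(\<lambda>n. inner (Re (w ^ n) *\<^sub>R fps_nth f n) c) sums inner (slice_re f w) c"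
      "(\<lambda>n. inner (Im (w ^ n) *\<^sub>R fps_nth f n) c) sums inner (slice_im f w) c"
      by (intro bounded_linear.sums[OF bounded_linear_inner_left] slice_re_sums slice_im_sums f w1)+
    ultimately have "Re (eval_fps G w) = inner (slice_re f w) c" "Im (eval_fps G w) = inner (slice_im f w) c"
      by (simp_all add: sums_iff mult.commute)
    then have "(cmod (eval_fps G w))\<^sup>2 = (inner (slice_re f w) c)\<^sup>2 + (inner (slice_im f w) c)\<^sup>2"
      by (simp add: cmod_power2)
    also have "\<dots> \<le> (norm (slice_re f w))\<^sup>2 * (norm c)\<^sup>2 + (norm (slice_im f w))\<^sup>2 * (norm c)\<^sup>2"
      using Cauchy_Schwarz_ineq[of "slice_re f w" c] Cauchy_Schwarz_ineq[of "slice_im f w" c]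
      unfolding power2_norm_eq_inner by linarith
    also have "\<dots> = slice_sq f w * (norm c)\<^sup>2" by (simp add: slice_sq_def algebra_simps)
    also have "\<dots> \<le> M\<^sup>2 * (norm c)\<^sup>2" using M(2)[OF w] by (intro mult_right_mono) simp_all
    finally have "(cmod (eval_fps G w))\<^sup>2 \<le> (norm c * M)\<^sup>2" by (simp add: power_mult_distrib mult.commute)
    then show ?thesis using M(1) by (rule power2_le_imp_le[OF _ mult_nonneg_nonneg[OF norm_ge_zero]])
  qed
  have "norm ((deriv ^^ k) (eval_fps G) 0) \<le> fact k * (norm c * M) / r ^ k"
  proof (rule Cauchy_inequality)
    show "eval_fps G holomorphic_on ball 0 r"
      using sub by (intro holomorphic_on_eval_fps) (auto simp: subset_iff)
    show "continuous_on (cball 0 r) (eval_fps G)"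
      by (rule continuous_on_subset[OF continuous_on_eval_fps sub])
  qed (use r bound in auto)
  moreover have "(deriv ^^ k) (eval_fps G) 0 = fact k * fps_nth G k"
    by (subst fps_nth_conv_deriv[OF less_le_trans[OF _ rad]]) simp_all
  ultimately have "norm (fps_nth G k) * r ^ k \<le> norm c * M"
    using r by (simp add: norm_mult field_simps)
  moreover have "norm (fps_nth G k) = norm c * norm c"
    by (simp add: G_def c_def dot_square_norm power2_eq_square norm_mult)
  ultimately have "norm c * (norm c * r ^ k) \<le> norm c * M" by (simp add: mult.assoc)
  then show ?thesis
    using M(1) by (cases "c = 0") (auto simp: c_def)
qed

text \<open>In \<open>norm_coeff_le\<close> take M^2 = 1 + e, let the radius tend to 1 and then e to
  0.\<close>

lemma norm_coeff_le_1:
  assumes f: "f \<in> H1" and lim: "(slice_sq f \<longlongrightarrow> 1) to_unit_circle"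
  shows "norm (fps_nth f k) \<le> 1"
proof -
  have "(norm (fps_nth f k))\<^sup>2 \<le> 1 + e" if "e > 0" for e
  proof -
    have "eventually (\<lambda>w. slice_sq f w < 1 + e) to_unit_circle"
      using that by (intro order_tendstoD(2)[OF lim]) simp
    then obtain Q where Q: "eventually Q (at_left 1)" "\<And>w. Q (cmod w) \<Longrightarrow> slice_sq f w < 1 + e"
      unfolding to_unit_circle_def eventually_filtercomap by blast
    have "eventually (\<lambda>r. norm (fps_nth f k) * r ^ k \<le> sqrt (1 + e)) (at_left 1)"
      using Q(1) eventually_at_left_1_interval
    proof eventually_elim
      case (elim r)
      then show ?case
        using Q(2) that by (intro norm_coeff_le f) (auto intro: less_imp_le)
    qed
    moreover have "((\<lambda>r. norm (fps_nth f k) * r ^ k) \<longlongrightarrow> norm (fps_nth f k) * 1 ^ k) (at_left (1::real))"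
      by (intro tendsto_intros)
    ultimately have "norm (fps_nth f k) * 1 ^ k \<le> sqrt (1 + e)"
      by (intro tendsto_upperbound) (auto simp: trivial_limit_at_left_real)
    then show ?thesis
      using that power_mono[of "norm (fps_nth f k)" "sqrt (1 + e)" 2] by simp
  qed
  then have "(norm (fps_nth f k))\<^sup>2 \<le> 1\<^sup>2" by (auto intro: field_le_epsilon)
  then show ?thesis by (rule power2_le_imp_le) simp
qed

section \<open>Boundary unitary series whose determinant has no zeros\<close>

lemma slice_const: "slice_re (fps_const c) w = c" "slice_im (fps_const c) w = 0"
proof -
  have "Re (w ^ k) *\<^sub>R fps_nth (fps_const c) k = (if k = 0 then c else 0)" for k
    by (cases k) auto
  then show "slice_re (fps_const c) w = c"
    unfolding slice_re_def by (subst suminf_finite[of "{0}"]) simp_all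
  have "Im (w ^ k) *\<^sub>R fps_nth (fps_const c) k = 0" for k
    by (cases k) auto
  then show "slice_im (fps_const c) w = 0" unfolding slice_im_def by (simp only: suminf_zero)
qed

lemma fps_const_in_H1 [simp]: "fps_const c \<in> H1"
  by (simp add: H1_iff)

lemma one_in_H1 [simp]: "1 \<in> H1"
  by (simp add: H1_iff)

lemma boundary_unitary_const: "norm c = 1 \<Longrightarrow> boundary_unitary (fps_const c)"
  by (simp add: boundary_unitary_def slice_sq_def[abs_def] slice_det_def slice_const complex_norm)

lemma H1_power: "f \<in> H1 \<Longrightarrow> f ^ n \<in> H1"
  by (induction n) (auto intro: H1_mult)

lemma boundary_unitary_power:
  assumes "f \<in> H1" "boundary_unitary f"
  shows "boundary_unitary (f ^ n)"
  using boundary_unitary_const[of 1]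
  by (induction n) (auto intro: boundary_unitary_mult assms H1_power)

text \<open>Normalize the constant term to 1. If the coefficients of \<open>g\<close> strictly
  between 0 and \<open>k\<close> vanish, then \<open>g ^ n\<close> has \<open>k\<close>-th
  coefficient n times that of \<open>g\<close>. Powers stay boundary unitary, so this is bounded by
  1 for every n and the coefficient must vanish.\<close>

lemma unimodular_constant:
  assumes f: "f \<in> H1" "boundary_unitary f" and 0: "norm (fps_nth f 0) = 1"
  shows "f = fps_const (fps_nth f 0)"
proof -
  define c where "c = inverse (fps_nth f 0)"
  define g where "g = f * fps_const c"
  have g: "g \<in> H1" "boundary_unitary g"
    unfolding g_def using f 0
    by (auto intro!: H1_mult boundary_unitary_mult boundary_unitary_const simp: c_def norm_inverse)
  have f0: "fps_nth f 0 \<noteq> 0" using 0 by auto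
  have g0: "fps_nth g 0 = 1" using f0 by (simp add: g_def c_def)
  have "fps_nth g k = 0" if "k > 0" for k
    using that
  proof (induction k rule: less_induct)
    case (less k)
    have pow: "fps_nth (g ^ n) 0 = 1 \<and> (\<forall>j. 0 < j \<and> j < k \<longrightarrow> fps_nth (g ^ n) j = 0) \<and>
        fps_nth (g ^ n) k = of_nat n * fps_nth g k" for n
    proof (induction n)
      case 0
      show ?case using less.prems by simp
    next
      case (Suc n)
      have "fps_nth (g ^ Suc n) j = (if j = 0 then 1 else if j = k then of_nat (Suc n) * fps_nth g k else 0)"
        if "j \<le> k" for j
      proof -
        have "fps_nth (g ^ Suc n) j = (\<Sum>i=0..j. fps_nth g i * fps_nth (g ^ n) (j - i))"
          by (simp add: fps_mult_nth)
        \<comment> \<open>For \<open>0 < i < j \<le> k\<close> the coefficient of \<open>g\<close>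
          at \<open>i\<close> vanishes by the induction on \<open>k\<close>.\<close>
        also have "\<dots> = (\<Sum>i\<in>{0, j}. fps_nth g i * fps_nth (g ^ n) (j - i))"
          using less.IH that by (intro sum.mono_neutral_right) auto
        finally show ?thesis
          using Suc.IH g0 less.IH that by (cases "j = 0") (auto simp: algebra_simps)
      qed
      then show ?case using less.prems g0 Suc.IH by auto
    qed
    have "real n * norm (fps_nth g k) \<le> 1" for n
      using norm_coeff_le_1[OF H1_power[OF g(1)], of n k] boundary_unitary_power[OF g, of n] pow[of n]
      by (simp add: boundary_unitary_def norm_mult)
    then have "norm (fps_nth g k) \<le> 0"
      by (meson ex_less_of_nat_mult not_le)
    then show ?case by simp
  qed
  with g0 have "g = 1" by (auto simp: fps_eq_iff)
  then have "fps_nth f k * c = (if k = 0 then 1 else 0)" for k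
    unfolding g_def fps_eq_iff by simp
  then have "fps_nth f k = 0" if "k > 0" for k
    using that f0 by (metis c_def divisors_zero inverse_nonzero_iff_nonzero less_numeral_extra(3))
  then show ?thesis by (auto simp: fps_eq_iff)
qed

text \<open>The coefficient bound applies to \<open>f\<close> and to its inverse, whose
  \<open>slice_sq\<close> also tends to 1. The two constant terms have product 1 and modulus at most
  1, so both are unimodular.\<close>

lemma boundary_unitary_no_zeros:
  assumes f: "f \<in> H1" "boundary_unitary f" and nz: "\<And>w. cmod w < 1 \<Longrightarrow> slice_det f w \<noteq> 0"
  shows "f = fps_const (fps_nth f 0)" "norm (fps_nth f 0) = 1"
proof -
  obtain g where g: "g \<in> H1" "f * g = 1"
    "\<And>w. cmod w < 1 \<Longrightarrow> slice_sq g w = slice_sq f w / (cmod (slice_det f w))\<^sup>2"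
    using inverse_in_H1[OF f(1) nz] by metis
  have "((\<lambda>w. slice_sq f w / (cmod (slice_det f w))\<^sup>2) \<longlongrightarrow> 1 / 1\<^sup>2) to_unit_circle"
    using f(2) unfolding boundary_unitary_def by (intro tendsto_intros) auto
  moreover have "eventually (\<lambda>w. slice_sq g w = slice_sq f w / (cmod (slice_det f w))\<^sup>2) to_unit_circle"
    using eventually_cmod_less_1 by (rule eventually_mono) (rule g(3))
  ultimately have "(slice_sq g \<longlongrightarrow> 1) to_unit_circle"
    by (simp add: tendsto_cong)
  then have g0: "norm (fps_nth g 0) \<le> 1" by (rule norm_coeff_le_1[OF g(1)])
  have f0: "norm (fps_nth f 0) \<le> 1"
    using f by (intro norm_coeff_le_1) (auto simp: boundary_unitary_def)
  have "fps_nth (f * g) 0 = 1" by (simp add: g(2))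
  then have "norm (fps_nth f 0) * norm (fps_nth g 0) = 1"
    by (simp flip: norm_mult)
  then show "norm (fps_nth f 0) = 1"
    using f0 g0 mult_left_le[of "norm (fps_nth g 0)" "norm (fps_nth f 0)"] by simp
  then show "f = fps_const (fps_nth f 0)" by (rule unimodular_constant[OF f])
qed

section \<open>Blaschke factors\<close>

text \<open>One minus the squared modulus equals (1 - |w|^2)(1 - |c|^2) / |1 - cnj(c) w|^2, whose
  denominator is at least (1 - |c|)^2 on the disc.\<close>

lemma moebius_tendsto:
  assumes "cmod c < 1"
  shows "((\<lambda>w. cmod ((w - c) / (1 - cnj c * w))) \<longlongrightarrow> 1) to_unit_circle"
proof -
  let ?m = "\<lambda>w. (cmod ((w - c) / (1 - cnj c * w)))\<^sup>2"
  have bound: "norm (?m w - 1) \<le> norm ((1 - (cmod w)\<^sup>2) / (1 - cmod c)\<^sup>2) * 1" if w: "cmod w < 1" for w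
  proof -
    have *: "(cmod (w - c))\<^sup>2 = (cmod (1 - cnj c * w))\<^sup>2 - (1 - (cmod w)\<^sup>2) * (1 - (cmod c)\<^sup>2)"
      unfolding cmod_power2 by (simp add: algebra_simps power2_eq_square)
    have "1 - cmod c \<le> 1 - cmod c * cmod w"
      using w assms by (simp add: mult_left_le)
    also have "\<dots> \<le> cmod (1 - cnj c * w)"
      using norm_triangle_ineq2[of 1 "cnj c * w"] by (simp add: norm_mult)
    finally have le: "1 - cmod c \<le> cmod (1 - cnj c * w)" .
    then have "0 < cmod (1 - cnj c * w)" using assms by linarith
    then have nz: "0 < (cmod (1 - cnj c * w))\<^sup>2" by (rule zero_less_power)
    have w2: "(cmod w)\<^sup>2 \<le> 1" "(cmod c)\<^sup>2 \<le> 1"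
      using w assms by (simp_all add: power_le_one)
    have "?m w - 1 = - ((1 - (cmod w)\<^sup>2) * (1 - (cmod c)\<^sup>2) / (cmod (1 - cnj c * w))\<^sup>2)"
      unfolding norm_divide power_divide * using nz by (simp only: diff_divide_distrib) simp
    then have "norm (?m w - 1) = (1 - (cmod w)\<^sup>2) * (1 - (cmod c)\<^sup>2) / (cmod (1 - cnj c * w))\<^sup>2"
      using w2 by (simp add: abs_mult)
    also have "\<dots> \<le> (1 - (cmod w)\<^sup>2) * 1 / (1 - cmod c)\<^sup>2"
      using w2 le assms by (intro frac_le mult_left_mono power_mono) (auto simp: zero_less_power)
    finally show ?thesis using w2 by simp
  qed
  have "((\<lambda>w. (1 - (cmod w)\<^sup>2) / (1 - cmod c)\<^sup>2) \<longlongrightarrow> (1 - 1\<^sup>2) / (1 - cmod c)\<^sup>2) to_unit_circle"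
    using assms by (intro tendsto_intros cmod_tendsto_1) auto
  then have lim: "((\<lambda>w. (1 - (cmod w)\<^sup>2) / (1 - cmod c)\<^sup>2) \<longlongrightarrow> 0) to_unit_circle" by simp
  have "((\<lambda>w. ?m w - 1) \<longlongrightarrow> 0) to_unit_circle"
    by (rule tendsto_0_le[OF lim eventually_mono[OF eventually_cmod_less_1 bound]])
  then have "(?m \<longlongrightarrow> 1) to_unit_circle" by (rule LIM_zero_cancel)
  from tendsto_real_sqrt[OF this] show ?thesis by simp
qed

lemma slice_X:
  "slice_re fps_X w = of_real (Re w)" "slice_im fps_X w = of_real (Im w)"
proof -
  have "Re (w ^ k) *\<^sub>R fps_nth fps_X k = (if k = 1 then of_real (Re w) else 0 :: quat)"
    "Im (w ^ k) *\<^sub>R fps_nth fps_X k = (if k = 1 then of_real (Im w) else 0 :: quat)" for k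
    by (simp_all add: of_real_def)
  then show "slice_re fps_X w = of_real (Re w)" "slice_im fps_X w = of_real (Im w)"
    unfolding slice_re_def slice_im_def by (subst suminf_finite[of "{1}"]; simp only: finite.intros; simp)+
qed

lemma fps_X_in_H1 [simp]: "fps_X \<in> H1"
  by (simp add: H1_iff)

lemma H1_diff: "f \<in> H1 \<Longrightarrow> g \<in> H1 \<Longrightarrow> f - g \<in> H1"
  unfolding H1_iff by (rule order_trans[OF _ fps_conv_radius_diff]) simp

lemma slice_diff:
  assumes "f \<in> H1" "g \<in> H1" "cmod w < 1"
  shows "slice_re (f - g) w = slice_re f w - slice_re g w"
    and "slice_im (f - g) w = slice_im f w - slice_im g w"
  using sums_diff[OF slice_re_sums[OF assms(1,3)] slice_re_sums[OF assms(2,3)]]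
    sums_diff[OF slice_im_sums[OF assms(1,3)] slice_im_sums[OF assms(2,3)]]
  by (simp_all add: slice_re_def slice_im_def sums_iff scaleR_diff_right)

definition geometric_fps :: "quat \<Rightarrow> quat fps" where
  "geometric_fps \<alpha> = Abs_fps (\<lambda>k. qcnj \<alpha> ^ k)"

text \<open>The linear polynomial inverse to the geometric series. Multiplying by it reduces
  statements on Blaschke factors to polynomial identities.\<close>

definition blaschke_denom :: "quat \<Rightarrow> quat fps" where
  "blaschke_denom \<alpha> = 1 - fps_const (qcnj \<alpha>) * fps_X"

lemma blaschke_factor_eq: "blaschke_factor \<alpha> = (fps_X - fps_const \<alpha>) * geometric_fps \<alpha>"
  by (simp add: blaschke_factor_def geometric_fps_def)

lemma geometric_mult_blaschke_denom: "geometric_fps \<alpha> * blaschke_denom \<alpha> = 1"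
proof (rule fps_ext)
  fix k
  have "geometric_fps \<alpha> * blaschke_denom \<alpha>
      = geometric_fps \<alpha> - geometric_fps \<alpha> * fps_const (qcnj \<alpha>) * fps_X"
    by (simp add: blaschke_denom_def right_diff_distrib mult.assoc)
  then show "fps_nth (geometric_fps \<alpha> * blaschke_denom \<alpha>) k = fps_nth 1 k"
    by (cases k) (simp_all add: geometric_fps_def power_commutes)
qed

lemma geometric_fps_in_H1:
  assumes "norm \<alpha> < 1"
  shows "geometric_fps \<alpha> \<in> H1"
  unfolding H1_iff_summable
proof safe
  fix r :: real assume r: "0 < r" "r < 1"
  have "norm \<alpha> * r \<le> norm \<alpha>" using r by (simp add: mult_left_le)
  then have "summable (\<lambda>k. (norm \<alpha> * r) ^ k)"
    using r assms by (intro summable_geometric) simp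
  then show "summable (\<lambda>k. norm (fps_nth (geometric_fps \<alpha>) k) * r ^ k)"
    by (simp add: geometric_fps_def norm_power power_mult_distrib)
qed

lemma blaschke_denom_in_H1 [simp]: "blaschke_denom \<alpha> \<in> H1"
  unfolding blaschke_denom_def by (intro H1_diff H1_mult) simp_all

lemma fps_X_minus_const_in_H1 [simp]: "fps_X - fps_const \<alpha> \<in> H1"
  by (intro H1_diff) simp_all

lemma blaschke_factor_in_H1: "norm \<alpha> < 1 \<Longrightarrow> blaschke_factor \<alpha> \<in> H1"
  unfolding blaschke_factor_eq by (intro H1_mult geometric_fps_in_H1) simp_all

lemma blaschke_factor_mult_denom: "blaschke_factor \<alpha> * blaschke_denom \<alpha> = fps_X - fps_const \<alpha>"
  by (simp add: blaschke_factor_eq mult.assoc geometric_mult_blaschke_denom)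

lemma fps_qcnj_blaschke_denom: "fps_qcnj (blaschke_denom \<alpha>) = 1 - fps_const \<alpha> * fps_X"
proof (rule fps_ext)
  fix k
  show "fps_nth (fps_qcnj (blaschke_denom \<alpha>)) k = fps_nth (1 - fps_const \<alpha> * fps_X) k"
    by (cases k; simp add: blaschke_denom_def) (auto simp: quat_eq_iff)
qed

lemma slice_num:
  assumes "cmod w < 1"
  shows "slice_re (fps_X - fps_const \<alpha>) w = of_real (Re w) - \<alpha>"
    "slice_im (fps_X - fps_const \<alpha>) w = of_real (Im w)"
  by (simp_all add: slice_diff assms slice_X slice_const)

lemma slice_denom:
  assumes "cmod w < 1"
  shows "slice_re (1 - fps_const \<alpha> * fps_X) w = 1 - Re w *\<^sub>R \<alpha>"
    "slice_im (1 - fps_const \<alpha> * fps_X) w = - (Im w *\<^sub>R \<alpha>)"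
  using slice_const[of 1 w]
  by (simp_all add: slice_diff slice_re_mult slice_im_mult H1_mult assms slice_X slice_const of_real_def)

text \<open>The root in the closed upper half plane of the characteristic polynomial
  \<open>z\<^sup>2 - 2 Re(\<alpha>) z + |\<alpha>|\<^sup>2\<close> of \<open>\<alpha>\<close>.\<close>

definition spectral_root :: "quat \<Rightarrow> complex" where
  "spectral_root \<alpha> = Complex (qre \<alpha>) (sqrt ((qi \<alpha>)\<^sup>2 + (qj \<alpha>)\<^sup>2 + (qk \<alpha>)\<^sup>2))"

lemma cmod_spectral_root: "cmod (spectral_root \<alpha>) = norm \<alpha>"
  by (simp add: spectral_root_def cmod_def norm_quat_def add.assoc)

lemma spectral_root_Im: "(Im (spectral_root \<alpha>))\<^sup>2 = (qi \<alpha>)\<^sup>2 + (qj \<alpha>)\<^sup>2 + (qk \<alpha>)\<^sup>2"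
  by (simp add: spectral_root_def)

text \<open>The determinant of w - \<alpha> is the characteristic polynomial of \<alpha> at w, here
  split into its two conjugate linear factors.\<close>

lemma slice_det_num:
  assumes "cmod w < 1"
  shows "slice_det (fps_X - fps_const \<alpha>) w = (w - spectral_root \<alpha>) * (w - cnj (spectral_root \<alpha>))"
proof -
  have "qre \<alpha> = Re (spectral_root \<alpha>)" by (simp add: spectral_root_def)
  with spectral_root_Im[of \<alpha>] show ?thesis
    by (simp add: slice_det_def slice_num assms complex_eq_iff norm_quat_power2 inner_quat_def of_real_def)
      (simp add: algebra_simps power2_eq_square)
qed

lemma slice_det_denom:
  assumes "cmod w < 1"
  shows "slice_det (1 - fps_const \<alpha> * fps_X) w = (1 - cnj (spectral_root \<alpha>) * w) * (1 - spectral_root \<alpha> * w)"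
proof -
  let ?a = "qre \<alpha>" and ?n = "(norm \<alpha>)\<^sup>2" and ?c = "spectral_root \<alpha>"
  have a: "Re ?c = ?a" by (simp add: spectral_root_def)
  have n: "(Im ?c)\<^sup>2 = ?n - ?a\<^sup>2" by (simp add: spectral_root_Im norm_quat_power2)
  have "(norm (1 - Re w *\<^sub>R \<alpha>))\<^sup>2 = 1 - 2 * Re w * ?a + (Re w)\<^sup>2 * ?n"
    unfolding norm_quat_power2 by (simp add: algebra_simps power2_eq_square)
  moreover have "(norm (- (Im w *\<^sub>R \<alpha>)))\<^sup>2 = (Im w)\<^sup>2 * ?n"
    by (simp add: power_mult_distrib)
  moreover have "inner (1 - Re w *\<^sub>R \<alpha>) (- (Im w *\<^sub>R \<alpha>)) = - Im w * ?a + Re w * Im w * ?n"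
    unfolding norm_quat_power2 inner_quat_def by (simp add: algebra_simps power2_eq_square)
  moreover have "(1 - cnj ?c * w) * (1 - ?c * w)
      = Complex (1 - 2 * ?a * Re w + (?a\<^sup>2 + (Im ?c)\<^sup>2) * ((Re w)\<^sup>2 - (Im w)\<^sup>2))
          (- (2 * ?a * Im w) + 2 * (?a\<^sup>2 + (Im ?c)\<^sup>2) * Re w * Im w)"
    by (simp add: complex_eq_iff a) (simp add: algebra_simps power2_eq_square)
  ultimately show ?thesis
    by (simp add: slice_det_def slice_denom assms n) (simp add: algebra_simps)
qed

text \<open>The quaternionic counterpart of |w - c|^2 = |1 - cnj(c) w|^2 - (1 - |w|^2)(1 - |c|^2).
  The second linear factor is the conjugate of \<open>blaschke_denom \<alpha>\<close>, so the
  product is the Blaschke factor with its denominator cleared to a real series.\<close>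

lemma slice_sq_num_denom:
  assumes "cmod w < 1"
  shows "slice_sq ((fps_X - fps_const \<alpha>) * (1 - fps_const \<alpha> * fps_X)) w
     = (cmod (slice_det (1 - fps_const \<alpha> * fps_X) w))\<^sup>2
       - (1 - (cmod w)\<^sup>2) * (1 - (norm \<alpha>)\<^sup>2) * slice_sq (1 - fps_const \<alpha> * fps_X) w"
proof -
  have H: "1 - fps_const \<alpha> * fps_X \<in> H1" by (intro H1_diff H1_mult) simp_all
  show ?thesis
    unfolding slice_sq_def slice_re_mult[OF fps_X_minus_const_in_H1 H assms]
      slice_im_mult[OF fps_X_minus_const_in_H1 H assms] slice_num[OF assms] slice_denom[OF assms]
      slice_det_def cmod_power2 norm_quat_power2 inner_quat_def complex.sel
    by (simp add: of_real_def) (simp add: algebra_simps power2_eq_square)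
qed

text \<open>The determinant is a product of two complex Moebius factors, at the spectral root and
  its conjugate, so its modulus tends to 1. Then \<open>slice_sq\<close> is squeezed between that
  modulus and the upper bound 1.\<close>

lemma boundary_unitary_blaschke:
  assumes "norm \<alpha> < 1"
  shows "boundary_unitary (blaschke_factor \<alpha>)"
proof -
  let ?b = "blaschke_factor \<alpha>" and ?d = "blaschke_denom \<alpha>" and ?e = "1 - fps_const \<alpha> * fps_X"
  let ?c = "spectral_root \<alpha>"
  have b: "?b \<in> H1" by (rule blaschke_factor_in_H1[OF assms])
  have e: "?e = fps_qcnj ?d" by (simp add: fps_qcnj_blaschke_denom)
  have c: "cmod ?c < 1" "cmod (cnj ?c) < 1" using assms by (simp_all add: cmod_spectral_root)
  have nz: "1 - z * w \<noteq> 0" if "cmod w < 1" "cmod z < 1" for z w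
  proof -
    have "cmod (z * w) < 1" using that norm_mult_less[of z 1 w 1] by simp
    then show ?thesis by auto
  qed
  have det: "slice_det ?b w = ((w - ?c) / (1 - cnj ?c * w)) * ((w - cnj ?c) / (1 - cnj (cnj ?c) * w))"
    and det_nz: "slice_det ?d w \<noteq> 0" if w: "cmod w < 1" for w
  proof -
    have "slice_det ?d w = slice_det ?e w"
      unfolding e by (simp add: slice_det_qcnj w)
    then have d: "slice_det ?d w = (1 - cnj ?c * w) * (1 - ?c * w)"
      by (simp add: slice_det_denom w)
    then show "slice_det ?d w \<noteq> 0" using nz w c by simp
    have "slice_det ?b w * slice_det ?d w = slice_det (fps_X - fps_const \<alpha>) w"
      using slice_det_mult[OF b blaschke_denom_in_H1[of \<alpha>] w] by (simp add: blaschke_factor_mult_denom)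
    then have "slice_det ?b w * ((1 - cnj ?c * w) * (1 - ?c * w)) = (w - ?c) * (w - cnj ?c)"
      by (simp add: d slice_det_num w)
    moreover have "1 - cnj ?c * w \<noteq> 0" "1 - ?c * w \<noteq> 0" using nz w c by simp_all
    ultimately show "slice_det ?b w = ((w - ?c) / (1 - cnj ?c * w)) * ((w - cnj ?c) / (1 - cnj (cnj ?c) * w))"
      by (simp add: nonzero_eq_divide_eq)
  qed
  have "((\<lambda>w. cmod ((w - ?c) / (1 - cnj ?c * w)) * cmod ((w - cnj ?c) / (1 - cnj (cnj ?c) * w))) \<longlongrightarrow> 1 * 1)
      to_unit_circle"
    by (intro tendsto_mult moebius_tendsto c)
  moreover have "eventually (\<lambda>w. cmod ((w - ?c) / (1 - cnj ?c * w)) * cmod ((w - cnj ?c) / (1 - cnj (cnj ?c) * w))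
      = cmod (slice_det ?b w)) to_unit_circle"
    using eventually_cmod_less_1 by eventually_elim (simp only: det norm_mult)
  ultimately have lim: "((\<lambda>w. cmod (slice_det ?b w)) \<longlongrightarrow> 1) to_unit_circle"
    by (simp add: tendsto_cong)
  have le: "slice_sq ?b w \<le> 1" if w: "cmod w < 1" for w
  proof -
    have prod: "?b * of_real_fps (norm_fps ?d) = (fps_X - fps_const \<alpha>) * ?e"
      unfolding e mult_fps_qcnj[symmetric] by (simp add: mult.assoc[symmetric] blaschke_factor_mult_denom)
    have "slice_sq ?b w * (cmod (slice_det ?d w))\<^sup>2 = slice_sq (?b * of_real_fps (norm_fps ?d)) w"
      by (simp add: slice_sq_mult_of_real_fps b norm_fps_in_H1 w eval_norm_fps)
    also have "\<dots> = (cmod (slice_det ?e w))\<^sup>2 - (1 - (cmod w)\<^sup>2) * (1 - (norm \<alpha>)\<^sup>2) * slice_sq ?e w"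
      unfolding prod by (rule slice_sq_num_denom[OF w])
    also have "\<dots> \<le> (cmod (slice_det ?e w))\<^sup>2"
      using w assms by (simp add: slice_sq_def power_le_one)
    also have "\<dots> = (cmod (slice_det ?d w))\<^sup>2"
      unfolding e by (simp add: slice_det_qcnj w)
    finally have "slice_sq ?b w * (cmod (slice_det ?d w))\<^sup>2 \<le> 1 * (cmod (slice_det ?d w))\<^sup>2" by simp
    then show ?thesis using det_nz[OF w] by (subst (asm) mult_le_cancel_right) auto
  qed
  have "(slice_sq ?b \<longlongrightarrow> 1) to_unit_circle"
    by (rule tendsto_sandwich[OF always_eventually[OF allI[OF cmod_slice_det_le]]
        eventually_mono[OF eventually_cmod_less_1 le] lim tendsto_const])
  with lim show ?thesis by (simp add: boundary_unitary_def)
qed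

section \<open>Factoring out zeros\<close>

text \<open>Since \<open>qre (x * y) = qre (y * x)\<close>, a series and its conjugate have the same
  norm series.\<close>

lemma fps_qcnj_mult_self: "fps_qcnj f * f = of_real_fps (norm_fps f)"
proof -
  have "qre (fps_nth (fps_qcnj f * f) k) = qre (fps_nth (f * fps_qcnj f) k)" for k
  proof -
    have comm: "qre (x * y) = qre (y * x)" for x y by simp
    have qre_sum: "qre (sum h A) = (\<Sum>i\<in>A. qre (h i))" for h :: "nat \<Rightarrow> quat" and A
      by (induction A rule: infinite_finite_induct) simp_all
    have "qre (fps_nth (fps_qcnj f * f) k) = (\<Sum>i=0..k. qre (fps_nth f (k - i) * qcnj (fps_nth f i)))"
      unfolding fps_mult_nth qre_sum by (intro sum.cong refl) (simp only: fps_qcnj_nth comm)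
    also have "\<dots> = qre (fps_nth (f * fps_qcnj f) k)"
      unfolding fps_mult_nth qre_sum
      by (rule sum.reindex_bij_witness[of _ "\<lambda>i. k - i" "\<lambda>i. k - i"]) auto
    finally show ?thesis .
  qed
  moreover have qq: "fps_qcnj (fps_qcnj f) = f" by (simp add: fps_eq_iff)
  ultimately have "norm_fps (fps_qcnj f) = norm_fps f"
    unfolding norm_fps_def by (simp only: qq)
  with mult_fps_qcnj[of "fps_qcnj f"] show ?thesis by (simp only: qq)
qed

text \<open>A zero of the determinant means that \<open>a\<close> and \<open>b\<close> are
  orthogonal and of equal length. Then - a b^(-1) is an imaginary unit, and the left value at the
  corresponding point vanishes; for \<open>b = 0\<close> also \<open>a = 0\<close> and any unit
  works.\<close>

lemma slice_det_zero_imp_left_zero: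
  assumes f: "f \<in> H1" and w: "cmod w < 1" and z: "slice_det f w = 0"
  obtains \<alpha> where "norm \<alpha> = cmod w" "eval_fps_left f \<alpha> = 0"
proof -
  define a b where "a = slice_re f w" and "b = slice_im f w"
  have ab: "norm a = norm b" "inner a b = 0"
    using z unfolding slice_det_def complex_eq_iff a_def[symmetric] b_def[symmetric]
    by simp_all
  obtain u where u: "imag_unit u" "a + u * b = 0"
  proof (cases "b = 0")
    case True
    with ab have "a + Quat 0 1 0 0 * b = 0" by simp
    then show thesis using imag_unit_axes(1) that by blast
  next
    case False
    let ?u = "- (a * inverse b)"
    have "norm ?u = 1" using False ab by (simp add: norm_mult norm_inverse)
    moreover have "qre (a * qcnj b) = inner a b" by (simp add: inner_quat_def)
    then have "qre ?u = 0" by (simp add: inverse_quat_def ab)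
    ultimately have "imag_unit ?u" by (simp add: imag_unit_def)
    moreover have "a + ?u * b = 0" using False by (simp add: mult.assoc)
    ultimately show thesis by (rule that)
  qed
  show thesis
  proof
    show "norm (of_real (Re w) + Im w *\<^sub>R u) = cmod w" by (rule norm_quat_slice[OF u(1)])
    show "eval_fps_left f (of_real (Re w) + Im w *\<^sub>R u) = 0"
      using u(2) by (simp add: eval_fps_left_slice f w u(1) a_def b_def)
  qed
qed

text \<open>Synthetic division: the tails \<open>t k\<close> satisfy
  \<open>t k = fps_nth f k + \<alpha> * t (Suc k)\<close>, and \<open>t 0\<close> is the left value
  at \<alpha>. The coefficients of the quotient are the tails shifted by one.\<close>

lemma left_zero_factor:
  assumes f: "f \<in> H1" and \<alpha>: "norm \<alpha> < 1" and z: "eval_fps_left f \<alpha> = 0"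
  obtains g where "g \<in> H1" "f = (fps_X - fps_const \<alpha>) * g"
proof -
  define t where "t k = (\<Sum>j. \<alpha> ^ j * fps_nth f (j + k))" for k
  \<comment> \<open>A bound C s^(-n) on the coefficients dominates the tail by a geometric series of
    ratio |\<alpha>| / s.\<close>
  have tail: "summable (\<lambda>j. norm (\<alpha> ^ j * fps_nth f (j + k)))
      \<and> norm (t k) \<le> C * inverse s ^ k * (s / (s - norm \<alpha>))"
    if s: "norm \<alpha> < s" "s < 1" and C: "\<And>n. norm (fps_nth f n) * s ^ n \<le> C" for s C k
  proof -
    have s0: "0 < s" using s(1) by (meson le_less_trans norm_ge_zero)
    have le: "norm (\<alpha> ^ j * fps_nth f (j + k)) \<le> C * inverse s ^ k * (norm \<alpha> / s) ^ j" for j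
    proof -
      have "norm (fps_nth f (j + k)) \<le> C * inverse s ^ (j + k)"
        using C[of "j + k"] s0 by (simp add: field_simps)
      then have "norm \<alpha> ^ j * norm (fps_nth f (j + k)) \<le> norm \<alpha> ^ j * (C * inverse s ^ (j + k))"
        by (intro mult_left_mono) simp_all
      then show ?thesis by (simp add: norm_mult norm_power power_add power_mult_distrib divide_inverse mult_ac)
    qed
    have geo: "(\<lambda>j. C * inverse s ^ k * (norm \<alpha> / s) ^ j) sums (C * inverse s ^ k * (1 / (1 - norm \<alpha> / s)))"
      using s s0 by (intro sums_mult geometric_sums) simp
    have sm: "summable (\<lambda>j. norm (\<alpha> ^ j * fps_nth f (j + k)))"
      by (rule summable_comparison_test'[OF sums_summable[OF geo], of 0]) (use le in simp)
    have "norm (t k) \<le> (\<Sum>j. norm (\<alpha> ^ j * fps_nth f (j + k)))"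
      unfolding t_def by (rule summable_norm[OF sm])
    also have "\<dots> \<le> C * inverse s ^ k * (1 / (1 - norm \<alpha> / s))"
      by (rule suminf_le[OF le sm sums_summable[OF geo], folded sums_unique[OF geo]])
    also have "1 / (1 - norm \<alpha> / s) = s / (s - norm \<alpha>)"
      using s0 s by (simp add: field_simps)
    finally show ?thesis using sm by simp
  qed
  have coeff: "\<exists>C. \<forall>n. norm (fps_nth f n) * s ^ n \<le> C" if "0 < s" "s < 1" for s
  proof -
    have "summable (\<lambda>n. norm (fps_nth f n) * s ^ n)"
      using f that by (simp add: H1_iff_summable)
    then have "Bseq (\<lambda>n. norm (fps_nth f n) * s ^ n)"
      by (intro convergent_imp_Bseq summable_imp_convergent)
    then obtain K where "\<And>n. norm (norm (fps_nth f n) * s ^ n) \<le> K" by (auto simp: Bseq_def)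
    then show ?thesis by (intro exI[of _ K]) (auto intro: order_trans[OF abs_ge_self])
  qed
  obtain s0 where s0: "norm \<alpha> < s0" "s0 < 1" using dense[OF \<alpha>] by blast
  have "0 < s0" using s0(1) by (meson le_less_trans norm_ge_zero)
  with coeff s0 obtain C0 where C0: "\<And>n. norm (fps_nth f n) * s0 ^ n \<le> C0" by blast
  have rec: "t k = fps_nth f k + \<alpha> * t (Suc k)" for k
  proof -
    have sm: "summable (\<lambda>j. \<alpha> ^ j * fps_nth f (j + k))" for k
      using tail[OF s0 C0] by (blast intro: summable_norm_cancel)
    have "t k = fps_nth f k + (\<Sum>j. \<alpha> * (\<alpha> ^ j * fps_nth f (j + Suc k)))"
      unfolding t_def using suminf_split_head[OF sm[of k]] by (simp add: mult.assoc)
    also have "(\<Sum>j. \<alpha> * (\<alpha> ^ j * fps_nth f (j + Suc k))) = \<alpha> * t (Suc k)"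
      unfolding t_def by (rule suminf_mult[OF sm])
    finally show ?thesis .
  qed
  have t0: "t 0 = 0" using z by (simp add: t_def eval_fps_left_def)
  define g where "g = Abs_fps (\<lambda>k. t (Suc k))"
  show thesis
  proof
    show "g \<in> H1"
      unfolding H1_iff_summable
    proof safe
      fix r :: real assume r: "0 < r" "r < 1"
      \<comment> \<open>\<open>norm \<alpha> < s\<close> is needed for the tail bound and
        \<open>r < s\<close> for summability against powers of \<open>r\<close>.\<close>
      obtain s where s: "max r (norm \<alpha>) < s" "s < 1" using dense[of "max r (norm \<alpha>)" 1] r \<alpha> by auto
      then obtain C where C: "\<And>n. norm (fps_nth f n) * s ^ n \<le> C" using coeff[of s] r by auto
      \<comment> \<open>The extra division by \<open>s\<close> comes from the index shift:
        coefficient \<open>k\<close> of \<open>g\<close> is \<open>t (Suc k)\<close>.\<close>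
      define D where "D = C * (s / (s - norm \<alpha>)) / s"
      have "summable (\<lambda>k. D * (r / s) ^ k)"
        using s r by (intro summable_mult summable_geometric) simp
      then show "summable (\<lambda>k. norm (fps_nth g k) * r ^ k)"
      proof (rule summable_comparison_test'[where N = 0])
        fix k
        have "norm (t (Suc k)) \<le> C * inverse s ^ Suc k * (s / (s - norm \<alpha>))"
          using tail[of s C "Suc k"] s C by auto
        then have "norm (t (Suc k)) * r ^ k \<le> C * inverse s ^ Suc k * (s / (s - norm \<alpha>)) * r ^ k"
          using r by (intro mult_right_mono) simp_all
        then show "norm (norm (fps_nth g k) * r ^ k) \<le> D * (r / s) ^ k"
          using r by (simp add: g_def D_def abs_mult power_divide divide_inverse power_mult_distrib mult_ac)
      qed
    qed
    show "f = (fps_X - fps_const \<alpha>) * g"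
    proof (rule fps_ext)
      fix k
      show "fps_nth f k = fps_nth ((fps_X - fps_const \<alpha>) * g) k"
        using rec[of k] t0 by (cases k) (simp_all add: g_def left_diff_distrib eq_neg_iff_add_eq_0)
    qed
  qed
qed

text \<open>The Blaschke factor has zeros, so it is not inverted. Instead multiply \<open>f\<close>
  by its conjugate: this gives a boundary unitary series equal to the quotient times a real series
  whose modulus tends to 1. Near the circle that scalar can be divided out of
  \<open>slice_sq\<close>, while the determinant is multiplicative.\<close>

lemma blaschke_division:
  assumes f: "f \<in> H1" "boundary_unitary f" and \<alpha>: "norm \<alpha> < 1" and z: "eval_fps_left f \<alpha> = 0"
  obtains h where "h \<in> H1" "boundary_unitary h" "f = blaschke_factor \<alpha> * h"
proof -
  obtain g where g: "g \<in> H1" "f = (fps_X - fps_const \<alpha>) * g"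
    using left_zero_factor[OF f(1) \<alpha> z] by metis
  let ?b = "blaschke_factor \<alpha>" and ?h = "blaschke_denom \<alpha> * g"
  have b: "?b \<in> H1" "boundary_unitary ?b"
    using \<alpha> by (simp_all add: blaschke_factor_in_H1 boundary_unitary_blaschke)
  have h: "?h \<in> H1" by (intro H1_mult g) simp
  have fac: "f = ?b * ?h"
    by (simp add: g(2) mult.assoc[symmetric] blaschke_factor_mult_denom)
  have bf: "boundary_unitary (fps_qcnj ?b * f)"
    using b f by (intro boundary_unitary_mult) (simp_all add: fps_qcnj_in_H1 boundary_unitary_qcnj)
  have "fps_qcnj ?b * f = of_real_fps (norm_fps ?b) * ?h"
    unfolding fps_qcnj_mult_self[symmetric] mult.assoc using fac by simp
  then have eq: "fps_qcnj ?b * f = ?h * of_real_fps (norm_fps ?b)"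
    by (simp only: of_real_fps_commute)
  let ?N = "\<lambda>w. cmod (slice_det ?b w)"
  have N: "(?N \<longlongrightarrow> 1) to_unit_circle" using b(2) by (simp add: boundary_unitary_def)
  have N_nz: "eventually (\<lambda>w. ?N w > 0) to_unit_circle"
    by (rule order_tendstoD(1)[OF N]) simp
  have "((\<lambda>w. slice_sq (fps_qcnj ?b * f) w / (?N w)\<^sup>2) \<longlongrightarrow> 1 / 1\<^sup>2) to_unit_circle"
    using bf N by (intro tendsto_intros) (auto simp: boundary_unitary_def)
  moreover have "eventually (\<lambda>w. slice_sq (fps_qcnj ?b * f) w / (?N w)\<^sup>2 = slice_sq ?h w) to_unit_circle"
    using eventually_cmod_less_1 N_nz
    by eventually_elim (simp add: eq slice_sq_mult_of_real_fps h norm_fps_in_H1 b eval_norm_fps)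
  ultimately have "(slice_sq ?h \<longlongrightarrow> 1) to_unit_circle" by (simp add: tendsto_cong)
  moreover have "((\<lambda>w. cmod (slice_det f w) / ?N w) \<longlongrightarrow> 1 / 1) to_unit_circle"
    using f(2) N by (intro tendsto_intros) (auto simp: boundary_unitary_def)
  moreover have "eventually (\<lambda>w. cmod (slice_det f w) / ?N w = cmod (slice_det ?h w)) to_unit_circle"
    using eventually_cmod_less_1 N_nz
    by eventually_elim (simp add: fac slice_det_mult b h norm_mult)
  ultimately have "boundary_unitary ?h" by (simp add: boundary_unitary_def tendsto_cong)
  from h this fac show thesis by (rule that)
qed

section \<open>Finite Blaschke products\<close>

lemma finite_blaschke_product_const: "norm c = 1 \<Longrightarrow> finite_blaschke_product (fps_const c)"
  unfolding finite_blaschke_product_def blaschke_product_of_degree_def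
  by (intro exI[of _ 0] exI[of _ "[]"] exI[of _ c]) simp

lemma finite_blaschke_product_factor_mult:
  assumes "norm \<alpha> < 1" "finite_blaschke_product h"
  shows "finite_blaschke_product (blaschke_factor \<alpha> * h)"
proof -
  obtain \<alpha>s \<phi> where "set \<alpha>s \<subseteq> ball 0 1" "norm \<phi> = 1"
    "h = prod_list (map blaschke_factor \<alpha>s) * fps_const \<phi>"
    using assms(2) by (auto simp: finite_blaschke_product_def blaschke_product_of_degree_def)
  then show ?thesis
    unfolding finite_blaschke_product_def blaschke_product_of_degree_def using assms(1)
    by (intro exI[of _ "length (\<alpha> # \<alpha>s)"] exI[of _ "\<alpha> # \<alpha>s"] exI[of _ \<phi>]) (simp add: mult.assoc)
qed

section \<open>Counting zeros by the modulus at the origin\<close>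

lemma boundary_unitary_zeros_bounded:
  assumes "boundary_unitary f"
  obtains \<rho> where "0 \<le> \<rho>" "\<rho> < 1" "\<And>w. cmod w < 1 \<Longrightarrow> slice_det f w = 0 \<Longrightarrow> cmod w \<le> \<rho>"
proof -
  have "eventually (\<lambda>w. 0 < cmod (slice_det f w)) to_unit_circle"
    using assms unfolding boundary_unitary_def by (intro order_tendstoD(1)[where y = 1]) simp_all
  then obtain Q where Q: "eventually Q (at_left 1)" "\<And>w. Q (cmod w) \<Longrightarrow> slice_det f w \<noteq> 0"
    unfolding to_unit_circle_def eventually_filtercomap by auto
  then obtain b where b: "b < 1" "\<And>y. b < y \<Longrightarrow> y < 1 \<Longrightarrow> Q y"
    using eventually_at_left[of "0::real" 1] by auto
  show thesis
  proof
    show "0 \<le> max 0 b" "max 0 b < 1" using b(1) by simp_all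
    fix w assume "cmod w < 1" "slice_det f w = 0"
    then have "\<not> b < cmod w" using b(2) Q(2) by blast
    then show "cmod w \<le> max 0 b" by simp
  qed
qed

lemma boundary_unitary_nonzero:
  assumes "boundary_unitary f"
  shows "f \<noteq> 0"
proof
  assume "f = 0"
  obtain \<rho> where \<rho>: "0 \<le> \<rho>" "\<rho> < 1" "\<And>w. cmod w < 1 \<Longrightarrow> slice_det f w = 0 \<Longrightarrow> cmod w \<le> \<rho>"
    using boundary_unitary_zeros_bounded[OF assms] by metis
  have "slice_det f w = 0" for w
    using slice_const[of 0 w] by (simp add: slice_det_def \<open>f = 0\<close> complex_eq_iff)
  \<comment> \<open>This point lies in the disc but outside radius \<open>\<rho>\<close>, where the
    determinant cannot vanish.\<close>
  with \<rho>(3)[of "of_real ((\<rho> + 1) / 2)"] \<rho>(1,2) show False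
    by (simp add: norm_divide del: of_real_divide of_real_add)
qed

text \<open>At the origin a Blaschke factor has modulus \<open>|\<alpha>| \<le> \<rho>\<close>, while a boundary unitary series has
  modulus at most 1, so that at most \<open>n\<close> zeros can be divided out.\<close>

lemma finite_blaschke_product_if_nonzero_at_0:
  assumes "f \<in> H1" "boundary_unitary f" and "0 \<le> \<rho>" "\<rho> < 1"
    and "\<And>w. cmod w < 1 \<Longrightarrow> slice_det f w = 0 \<Longrightarrow> cmod w \<le> \<rho>"
    and "\<rho> ^ n < norm (fps_nth f 0)"
  shows "finite_blaschke_product f"
  using assms(1,2,5,6)
proof (induction n arbitrary: f)
  case 0
  \<comment> \<open>For \<open>n = 0\<close> the hypothesis reads 1 < |f_0|, contradicting the
    coefficient bound.\<close>
  then show ?case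
    using norm_coeff_le_1[of f 0] by (simp add: boundary_unitary_def)
next
  case (Suc n)
  show ?case
  proof (cases "\<exists>w. cmod w < 1 \<and> slice_det f w = 0")
    case False
    then show ?thesis
      using boundary_unitary_no_zeros[OF Suc.prems(1,2)] finite_blaschke_product_const by metis
  next
    case True
    then obtain w where w: "cmod w < 1" "slice_det f w = 0" by blast
    obtain \<alpha> where \<alpha>: "norm \<alpha> = cmod w" "eval_fps_left f \<alpha> = 0"
      using slice_det_zero_imp_left_zero[OF Suc.prems(1) w] by metis
    have \<alpha>1: "norm \<alpha> < 1" using \<alpha> w by simp
    have \<alpha>\<rho>: "norm \<alpha> \<le> \<rho>" using Suc.prems(3) w \<alpha> by simp
    obtain h where h: "h \<in> H1" "boundary_unitary h" "f = blaschke_factor \<alpha> * h"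
      using blaschke_division[OF Suc.prems(1,2) \<alpha>1 \<alpha>(2)] by metis
    have "norm (fps_nth f 0) = norm \<alpha> * norm (fps_nth h 0)"
      by (simp add: h(3) blaschke_factor_def norm_mult)
    also have "\<dots> \<le> \<rho> * norm (fps_nth h 0)"
      using \<alpha>\<rho> by (rule mult_right_mono) simp
    finally have "\<rho> * \<rho> ^ n < \<rho> * norm (fps_nth h 0)" using Suc.prems(4) by simp
    then have "\<rho> ^ n < norm (fps_nth h 0)"
      using \<open>0 \<le> \<rho>\<close> by (rule mult_left_less_imp_less)
    \<comment> \<open>Zeros of the quotient's determinant are zeros of the original one, so the same
      \<open>\<rho>\<close> serves throughout the induction.\<close>
    moreover have "cmod v \<le> \<rho>" if "cmod v < 1" "slice_det h v = 0" for v
      using Suc.prems(3)[OF that(1)] that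
      by (simp add: h(3) slice_det_mult blaschke_factor_in_H1 \<alpha>1 h(1))
    ultimately have "finite_blaschke_product h"
      by (intro Suc.IH h(1,2))
    then show ?thesis unfolding h(3) by (rule finite_blaschke_product_factor_mult[OF \<alpha>1])
  qed
qed

lemma blaschke_factor_0: "blaschke_factor 0 = fps_X"
proof -
  have "qcnj 0 = 0" by (simp add: quat_eq_iff)
  then have "geometric_fps 0 = 1" by (simp add: geometric_fps_def fps_eq_iff power_0_left)
  then show ?thesis by (simp add: blaschke_factor_eq)
qed

text \<open>The count by the modulus at the origin requires a nonzero constant term. Zeros at the
  origin are removed first, by dividing by \<open>blaschke_factor 0\<close>, which is
  \<open>fps_X\<close>; each division lowers the index \<open>m\<close> of a nonzero coefficient by
  one.\<close>

lemma boundary_unitary_imp_finite_blaschke_product: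
  assumes "f \<in> H1" "boundary_unitary f"
  shows "finite_blaschke_product f"
proof -
  have base: "finite_blaschke_product f"
    if f: "f \<in> H1" "boundary_unitary f" "fps_nth f 0 \<noteq> 0" for f
  proof -
    obtain \<rho> where \<rho>: "0 \<le> \<rho>" "\<rho> < 1" "\<And>w. cmod w < 1 \<Longrightarrow> slice_det f w = 0 \<Longrightarrow> cmod w \<le> \<rho>"
      using boundary_unitary_zeros_bounded[OF f(2)] by metis
    obtain n where "\<rho> ^ n < norm (fps_nth f 0)"
      using real_arch_pow_inv[of "norm (fps_nth f 0)" \<rho>] f(3) \<rho>(2) by auto
    then show ?thesis
      by (intro finite_blaschke_product_if_nonzero_at_0[where \<rho> = \<rho>] f \<rho>)
  qed
  obtain m where "fps_nth f m \<noteq> 0"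
    using boundary_unitary_nonzero[OF assms(2)] by (auto simp: fps_eq_iff)
  with assms show ?thesis
  proof (induction m arbitrary: f)
    case (0 f)
    then show ?case by (rule base)
  next
    case (Suc m f)
    show ?case
    proof (cases "fps_nth f 0 = 0")
      case False
      with Suc.prems(1,2) show ?thesis by (rule base)
    next
      case True
      have "eval_fps_left f 0 = slice_re f 0 + Quat 0 1 0 0 * slice_im f 0"
        using eval_fps_left_slice[OF Suc.prems(1) _ imag_unit_axes(1), of 0] by simp
      then have "eval_fps_left f 0 = 0" using True by (simp add: slice_zero)
      then obtain h where h: "h \<in> H1" "boundary_unitary h" "f = blaschke_factor 0 * h"
        using blaschke_division[OF Suc.prems(1,2), of 0] by auto
      then have "fps_nth h m \<noteq> 0" using Suc.prems(3) by (simp add: blaschke_factor_0)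
      then have "finite_blaschke_product h" by (intro Suc.IH h)
      then show ?thesis unfolding h(3) by (intro finite_blaschke_product_factor_mult) simp_all
    qed
  qed
qed

theorem theorem3p10:
  fixes f :: "quat fps"
  assumes "f \<in> H1"
  shows "(((\<lambda>\<gamma>. norm (eval_fps_left f \<gamma>)) \<longlongrightarrow> 1) to_unit_sphere \<longleftrightarrow>
          ((\<lambda>\<gamma>. norm (eval_fps f \<gamma>)) \<longlongrightarrow> 1) to_unit_sphere) \<and>
         (((\<lambda>\<gamma>. norm (eval_fps_left f \<gamma>)) \<longlongrightarrow> 1) to_unit_sphere \<and>
          ((\<lambda>\<gamma>. norm (eval_fps f \<gamma>)) \<longlongrightarrow> 1) to_unit_sphere \<longrightarrow>
          finite_blaschke_product f)"
  using boundary_unitary_iff_left[OF assms] boundary_unitary_iff_right[OF assms]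
    boundary_unitary_imp_finite_blaschke_product[OF assms] by blast

end
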